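(* Let $X_1,X_2,\ldots$ be iid random variables with distribution function $F$ whose quantile function satisfies $Q(1-s)=s^{-\gamma}\ell(s)$, $s\in(0,1)$, where $\gamma>0$ and $\ell$ is slowly varying at $0$. Let $p>0$ be fixed, and let $(k_n)$ be a sequence of integers with $1\le k_n\le n$, $k_n\to\infty$, $k_n/n\to 0$, and $(\log n)^\delta/k_n\to 0$ for some $\delta>0$. Then, as $n\to\infty$, $$S_n(p)\longrightarrow \gamma^p\,\Gamma(p+1)\quad\text{almost surely};$$ that is, $\widehat\gamma(n)=\left(S_n(p)/\Gamma(p+1)\right)^{1/p}\to\gamma$ almost surely.
   Context: $Q(s)=\inf\{x: F(x)\ge s\}$, $s\in(0,1)$, is the quantile function of $F$. $X_{1,n}\le\ldots\le X_{n,n}$ are the order statistics of $X_1,\ldots,X_n$. For $p>0$, $$S_n(p)=\frac1{k_n}\sum_{i=1}^{k_n}\left(\log\frac{X_{n+1-i,n}}{X_{n-k_n,n}}\right)^p .$$ This is considered for $n$ large: $k_n<n$ eventually since $k_n/n\to0$, and almost surely $X_{n-k_n,n}>0$ for all large $n$. $\Gamma$ is the gamma function. A function $\ell$ is slowly varying at $0$ if it is positive near $0$ (and measurable) and $\ell(us)/\ell(s)\to1$ as $s\downarrow0$ for each $u>0$. *)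

theory Defs
  imports "HOL-Probability.Probability"
begin

definition quantile :: "(real \<Rightarrow> real) \<Rightarrow> real \<Rightarrow> real" where
  "quantile F s = Inf {x. s \<le> F x}"

definition slowly_varying_at_0 :: "(real \<Rightarrow> real) \<Rightarrow> bool" where
  "slowly_varying_at_0 l \<longleftrightarrow>
     (\<exists>e>0. (\<forall>s\<in>{0<..<e}. 0 < l s) \<and> l \<in> borel_measurable (restrict_space borel {0<..<e})) \<and>
     (\<forall>u>0. ((\<lambda>s. l (u * s) / l s) \<longlongrightarrow> 1) (at_right 0))"

text \<open>The sample of size \<open>n\<close> is \<open>X 1, \<dots>, X n\<close>, and \<open>order_statistic X n j \<omega>\<close> is its \<open>j\<close>-th
  smallest value, counted with multiplicity. It is meaningful only for \<open>1 \<le> j \<le> n\<close>.\<close>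

definition order_statistic :: "(nat \<Rightarrow> 'a \<Rightarrow> real) \<Rightarrow> nat \<Rightarrow> nat \<Rightarrow> 'a \<Rightarrow> real" where
  "order_statistic X n j \<omega> = sort (map (\<lambda>i. X i \<omega>) [1..<n + 1]) ! (j - 1)"

text \<open>Meaningful when \<open>1 \<le> k n < n\<close> and the \<open>(n - k n)\<close>-th order statistic is positive. The
  logarithms are then nonnegative, and a vanishing one contributes \<open>0 powr p = 0\<close>, which is
  the intended value for \<open>p > 0\<close>.\<close>

definition S_stat :: "(nat \<Rightarrow> 'a \<Rightarrow> real) \<Rightarrow> (nat \<Rightarrow> nat) \<Rightarrow> real \<Rightarrow> nat \<Rightarrow> 'a \<Rightarrow> real" where
  "S_stat X k p n \<omega> =
     1 / real (k n) *
     (\<Sum>i=1..k n. ln (order_statistic X n (n + 1 - i) \<omega> / order_statistic X n (n - k n) \<omega>) powr p)"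

definition gamma_hat :: "(nat \<Rightarrow> 'a \<Rightarrow> real) \<Rightarrow> (nat \<Rightarrow> nat) \<Rightarrow> real \<Rightarrow> nat \<Rightarrow> 'a \<Rightarrow> real" where
  "gamma_hat X k p n \<omega> = (S_stat X k p n \<omega> / Gamma (p + 1)) powr (1 / p)"

end

theory Submission
  imports Defs "HOL-Real_Asymp.Real_Asymp"
begin

text \<open>
  Writing \<open>N\<^sub>n y\<close> for the number of observations above \<open>y\<close> and \<open>T\<close> for the random threshold
  \<open>X\<^bsub>n-k,n\<^esub>\<close>, one has
  \<open>S\<^sub>n(p) = \<gamma>\<^sup>p p \<integral> s powr (p - 1) * N\<^sub>n (T exp (\<gamma> s)) / k ds\<close> over \<open>s \<ge> 0\<close>, so it suffices that
  almost surely \<open>N\<^sub>n (T exp (\<gamma> s)) / k \<longlonglongrightarrow> exp (- s)\<close>, with an integrable bound \<open>C exp (- b s)\<close>.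

  Both follow from almost sure control of \<open>N\<^sub>n\<close> at the levels \<open>q u = Q (1 - u)\<close>. By Chernoff bounds on
  a geometric grid in \<open>n\<close> and \<open>u\<close> and Borel--Cantelli, \<open>N\<^sub>n (q u) \<sim> n u\<close> uniformly in
  \<open>n u \<ge> (log n)\<^sup>\<eta>\<close>, for every \<open>\<eta> > 0\<close>; the logarithmic number of blocks in \<open>n\<close> is what makes any
  power of \<open>log n\<close> sufficient. Moreover no observation
  exceeds \<open>q u\<close> once \<open>n u (log n)\<^sup>2 < 1\<close>. For \<open>k \<ge> (log n)\<^sup>\<delta>\<close> and \<open>\<eta> = \<delta> / 2\<close> these combine to
  \<open>N\<^sub>n (q u) \<le> C k (n u / k)\<^sup>a\<close> for \<open>u \<le> k / n\<close> and a small \<open>a > 0\<close>. Regular variation of the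
  monotone function \<open>q\<close> translates levels \<open>q u\<close> into multiples of \<open>T\<close>.
\<close>

section \<open>Order statistics\<close>

text \<open>Sorting only permutes the sample, so exceedance counts can be read off positions of the
  sorted list. Sample indices start at 1, list positions at 0.\<close>

lemma card_filter_sort:
  fixes x :: "nat \<Rightarrow> real"
  shows "card {i \<in> {1..n}. P (x i)} = card {j. j < n \<and> P (sort (map x [1..<n + 1]) ! j)}"
proof -
  let ?xs = "sort (map x [1..<n + 1])"
  have "card {j. j < length ?xs \<and> P (?xs ! j)} = length (filter P ?xs)"
    by (rule length_filter_conv_card [symmetric])
  also have "\<dots> = length (filter P (map x [1..<n + 1]))"
    by (simp only: filter_sort length_sort)
  also have "\<dots> = length (filter (\<lambda>i. P (x i)) [1..<n + 1])"
    by (simp add: filter_map o_def)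
  also have "\<dots> = card (set (filter (\<lambda>i. P (x i)) [1..<n + 1]))"
    by (rule distinct_card [symmetric]) auto
  also have "set (filter (\<lambda>i. P (x i)) [1..<n + 1]) = {i \<in> {1..n}. P (x i)}"
    by auto
  finally show ?thesis by (simp del: upt_Suc)
qed

context
  fixes X :: "nat \<Rightarrow> 'a \<Rightarrow> real" and \<omega> :: 'a and n k :: nat
  assumes k: "1 \<le> k" "k < n"
begin

private lemma sort_nth_le:
  assumes "i \<le> j" "j < n"
  shows "sort (map (\<lambda>i. X i \<omega>) [1..<n + 1]) ! i \<le> sort (map (\<lambda>i. X i \<omega>) [1..<n + 1]) ! j"
  using assms by (intro sorted_nth_mono) auto

lemma card_above_order_statistic_le:
  "card {i \<in> {1..n}. order_statistic X n (n - k) \<omega> < X i \<omega>} \<le> k"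
proof -
  let ?xs = "sort (map (\<lambda>i. X i \<omega>) [1..<n + 1])"
  \<comment> \<open>The \<open>(n - k)\<close>-th order statistic sits at list position
    \<open>n - k - 1\<close>, so strictly larger values occur only at the \<open>k\<close> positions
    behind it.\<close>
  have "{j. j < n \<and> order_statistic X n (n - k) \<omega> < ?xs ! j} \<subseteq> {n - k..<n}"
  proof
    fix j assume j: "j \<in> {j. j < n \<and> order_statistic X n (n - k) \<omega> < ?xs ! j}"
    have "\<not> j \<le> n - k - 1"
      using sort_nth_le [of j "n - k - 1"] j k by (auto simp: order_statistic_def)
    then show "j \<in> {n - k..<n}" using j k by auto
  qed
  then have "card {j. j < n \<and> order_statistic X n (n - k) \<omega> < ?xs ! j} \<le> card {n - k..<n}"
    by (intro card_mono) auto
  then show ?thesis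
    using k card_filter_sort [where x = "\<lambda>i. X i \<omega>" and n = n
      and P = "\<lambda>z. order_statistic X n (n - k) \<omega> < z"] by simp
qed

text \<open>Otherwise all values \<open>\<ge> y\<close> would lie strictly above the order
  statistic, where there are only \<open>k\<close> positions. Together with the next lemma this
  turns count bounds at a fixed level into bounds for the random threshold; because of ties, one
  needs weak and the other strict exceedances.\<close>

lemma order_statistic_geI:
  assumes "k < card {i \<in> {1..n}. y \<le> X i \<omega>}"
  shows "y \<le> order_statistic X n (n - k) \<omega>"
proof (rule ccontr)
  let ?xs = "sort (map (\<lambda>i. X i \<omega>) [1..<n + 1])"
  assume less: "\<not> ?thesis"
  have "{j. j < n \<and> y \<le> ?xs ! j} \<subseteq> {n - k..<n}"
  proof
    fix j assume j: "j \<in> {j. j < n \<and> y \<le> ?xs ! j}"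
    have "\<not> j \<le> n - k - 1"
      using sort_nth_le [of j "n - k - 1"] j k less by (auto simp: order_statistic_def)
    then show "j \<in> {n - k..<n}" using j k by auto
  qed
  then have "card {j. j < n \<and> y \<le> ?xs ! j} \<le> card {n - k..<n}"
    by (intro card_mono) auto
  then show False
    using assms k card_filter_sort [where x = "\<lambda>i. X i \<omega>" and n = n and P = "\<lambda>z. y \<le> z"]
    by simp
qed

text \<open>Otherwise the \<open>k + 1\<close> positions from \<open>n - k - 1\<close> on would all
  hold values above \<open>y\<close>.\<close>

lemma order_statistic_leI:
  assumes "card {i \<in> {1..n}. y < X i \<omega>} \<le> k"
  shows "order_statistic X n (n - k) \<omega> \<le> y"
proof (rule ccontr)
  let ?xs = "sort (map (\<lambda>i. X i \<omega>) [1..<n + 1])"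
  assume less: "\<not> ?thesis"
  have "{n - k - 1..<n} \<subseteq> {j. j < n \<and> y < ?xs ! j}"
  proof
    fix j assume j: "j \<in> {n - k - 1..<n}"
    then have "?xs ! (n - k - 1) \<le> ?xs ! j"
      by (intro sort_nth_le) auto
    then show "j \<in> {j. j < n \<and> y < ?xs ! j}"
      using j less by (auto simp: order_statistic_def)
  qed
  then have "card {n - k - 1..<n} \<le> card {j. j < n \<and> y < ?xs ! j}"
    by (intro card_mono) auto
  then show False
    using assms k card_filter_sort [where x = "\<lambda>i. X i \<omega>" and n = n and P = "\<lambda>z. y < z"]
    by simp
qed

text \<open>Summing over the sample instead of the top \<open>k\<close> order statistics removes the
  ordering. Ties at the threshold are harmless: such an observation contributes
  \<open>ln 1 powr p = 0\<close>, so it may be counted or dropped.\<close>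

lemma S_stat_eq_sum_exceedances:
  assumes k_n: "k' n = k" and pos: "0 < order_statistic X n (n - k) \<omega>" and p: "0 < p"
  defines "T \<equiv> order_statistic X n (n - k) \<omega>"
  shows "S_stat X k' p n \<omega> =
    1 / real k * (\<Sum>i=1..n. if T < X i \<omega> then ln (X i \<omega> / T) powr p else 0)"
proof -
  let ?xs = "sort (map (\<lambda>i. X i \<omega>) [1..<n + 1])"
  define g where "g y = (if T < y then ln (y / T) powr p else 0)" for y
  have T: "T = ?xs ! (n - k - 1)" by (simp add: T_def order_statistic_def)
  have "(\<Sum>i=1..k. ln (order_statistic X n (n + 1 - i) \<omega> / T) powr p)
      = (\<Sum>j\<in>{n - k..<n}. ln (?xs ! j / T) powr p)"
    \<comment> \<open>The order statistic with number \<open>n + 1 - i\<close> has list position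
      \<open>n - i\<close>.\<close>
    by (rule sum.reindex_bij_witness [where i = "\<lambda>j. n - j" and j = "\<lambda>i. n - i"])
       (use k in \<open>auto simp: order_statistic_def\<close>)
  also have "\<dots> = (\<Sum>j\<in>{n - k..<n}. g (?xs ! j))"
  proof (rule sum.cong [OF refl])
    fix j assume j: "j \<in> {n - k..<n}"
    then have "T \<le> ?xs ! j" unfolding T by (intro sort_nth_le) auto
    then show "ln (?xs ! j / T) powr p = g (?xs ! j)"
      using pos p by (cases "T = ?xs ! j") (auto simp: g_def T_def)
  qed
  also have "\<dots> = (\<Sum>j\<in>{0..<n}. g (?xs ! j))"
  proof (rule sum.mono_neutral_left)
    show "\<forall>j\<in>{0..<n} - {n - k..<n}. g (?xs ! j) = 0"
    proof
      fix j assume j: "j \<in> {0..<n} - {n - k..<n}"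
      then have "?xs ! j \<le> T" unfolding T using k by (intro sort_nth_le) auto
      then show "g (?xs ! j) = 0" by (simp add: g_def)
    qed
  qed auto
  also have "\<dots> = sum_list (map g ?xs)"
    by (simp add: sum_list_sum_nth)
  also have "\<dots> = sum_mset (image_mset g (mset ?xs))"
    by (metis mset_map sum_mset_sum_list)
  also have "\<dots> = sum_list (map g (map (\<lambda>i. X i \<omega>) [1..<n + 1]))"
    by (metis mset_map mset_sort sum_mset_sum_list)
  also have "\<dots> = (\<Sum>i\<in>set [1..<n + 1]. g (X i \<omega>))"
    by (simp add: sum_list_distinct_conv_sum_set o_def del: upt_Suc)
  also have "set [1..<n + 1] = {1..n}" by auto
  finally show ?thesis
    using k_n by (simp add: S_stat_def g_def T_def)
qed

end

section \<open>Integrals of exceedance counts\<close>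

text \<open>The indicator cuts \<open>s powr (p - 1)\<close> off at
  \<open>c = ln (x / T) / \<gamma>\<close>, which leaves \<open>c powr p / p\<close>. The factor
  \<open>\<gamma>\<close> in the exponent is there so that the normalised counts later converge to
  \<open>exp (- s)\<close>.\<close>

lemma has_integral_exceedance:
  fixes T \<gamma> p x :: real
  assumes T: "0 < T" and \<gamma>: "0 < \<gamma>" and p: "0 < p"
  shows "((\<lambda>s. (if T * exp (\<gamma> * s) < x then 1 else 0) * s powr (p - 1)) has_integral
    (if T < x then ln (x / T) powr p else 0) / (\<gamma> powr p * p)) {0..}"
proof (cases "T < x")
  case True
  define c where "c = ln (x / T) / \<gamma>"
  have c: "0 < c" using True T \<gamma> by (simp add: c_def)
  have less_iff: "T * exp (\<gamma> * s) < x \<longleftrightarrow> s < c" for s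
  proof -
    have "T * exp (\<gamma> * s) < x \<longleftrightarrow> exp (\<gamma> * s) < exp (ln (x / T))"
      using T True by (simp add: field_simps)
    also have "\<dots> \<longleftrightarrow> s < c"
      using \<gamma> by (simp add: c_def field_simps del: exp_ln)
    finally show ?thesis .
  qed
  have "((\<lambda>s. s powr (p - 1)) has_integral c powr p / p) {0..c}"
    using has_integral_powr_from_0 [of "p - 1" c] p c by simp
  then have "((\<lambda>s. if s \<in> {0..c} then s powr (p - 1) else 0) has_integral c powr p / p) {0..}"
    by (subst has_integral_restrict) auto
  \<comment> \<open>The two integrands differ only at \<open>s = c\<close>, where the strict
    inequality fails.\<close>
  then have "((\<lambda>s. (if T * exp (\<gamma> * s) < x then 1 else 0) * s powr (p - 1))
      has_integral c powr p / p) {0..}"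
    by (rule has_integral_spike_finite [of "{c}", rotated 2]) (auto simp: less_iff)
  moreover have "c powr p = ln (x / T) powr p / \<gamma> powr p"
    using True T \<gamma> by (simp add: c_def powr_divide)
  ultimately show ?thesis using True by simp
next
  case False
  have "\<not> T * exp (\<gamma> * s) < x" if "0 \<le> s" for s
  proof -
    have "1 \<le> exp (\<gamma> * s)" using \<gamma> that by simp
    with T have "T * 1 \<le> T * exp (\<gamma> * s)" by (intro mult_left_mono) auto
    with False show ?thesis by simp
  qed
  then show ?thesis using False
    by (auto intro!: has_integral_is_0)
qed

lemma has_integral_exceedance_count:
  fixes T \<gamma> p :: real and x :: "nat \<Rightarrow> real"
  assumes "0 < T" "0 < \<gamma>" "0 < p"
  shows "((\<lambda>s. real (card {i \<in> {1..n}. T * exp (\<gamma> * s) < x i}) * s powr (p - 1)) has_integral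
    (\<Sum>i=1..n. if T < x i then ln (x i / T) powr p else 0) / (\<gamma> powr p * p)) {0..}"
proof -
  have "((\<lambda>s. \<Sum>i=1..n. (if T * exp (\<gamma> * s) < x i then 1 else 0) * s powr (p - 1)) has_integral
    (\<Sum>i=1..n. (if T < x i then ln (x i / T) powr p else 0) / (\<gamma> powr p * p))) {0..}"
    by (intro has_integral_sum has_integral_exceedance assms) simp
  moreover have "real (card {i \<in> {1..n}. T * exp (\<gamma> * s) < x i})
      = (\<Sum>i=1..n. if T * exp (\<gamma> * s) < x i then 1 else 0)" for s
    by (simp add: sum.If_cases Int_def)
  ultimately show ?thesis
    by (simp add: sum_divide_distrib sum_distrib_right)
qed

text \<open>On the open half-line this function is the norm of the complex Gamma integrand with rate
  \<open>b\<close>; the endpoint 0 is a null set. It serves as majorant in the dominated convergence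
  below.\<close>

lemma powr_exp_integrable_on:
  fixes p b :: real
  assumes p: "0 < p" and b: "0 < b"
  shows "(\<lambda>s. exp (- b * s) * s powr (p - 1)) integrable_on {0..}"
proof -
  have "(\<lambda>t. norm (complex_of_real t powr (complex_of_real p - 1) / of_real (exp (b * t))))
      integrable_on {0<..}"
    using absolutely_integrable_Gamma_integral [of "complex_of_real p" b] p b
    by (simp add: absolutely_integrable_on_def)
  then have "(\<lambda>s. exp (- b * s) * s powr (p - 1)) integrable_on {0<..}"
    by (rule integrable_eq)
       (auto simp: norm_divide norm_powr_real_powr exp_minus field_simps simp flip: of_real_diff)
  then show ?thesis
    by (rule integrable_spike_set) (auto intro: negligible_subset [of "{0}"])
qed

text \<open>Dominated convergence towards Euler's integral. The hypotheses hold only eventually, so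
  the sequence is shifted by \<open>N\<close> first.\<close>

lemma tendsto_Gamma_of_tail_functions:
  fixes R :: "nat \<Rightarrow> real \<Rightarrow> real" and y :: "nat \<Rightarrow> real"
  assumes p: "0 < p" and b: "0 < b"
    and int: "eventually (\<lambda>n. ((\<lambda>s. R n s * s powr (p - 1)) has_integral y n) {0..}) sequentially"
    and dom: "eventually (\<lambda>n. \<forall>s\<ge>0. \<bar>R n s\<bar> \<le> C * exp (- b * s)) sequentially"
    and lim: "\<And>s. 0 < s \<Longrightarrow> (\<lambda>n. R n s) \<longlonglongrightarrow> exp (- s)"
  shows "y \<longlonglongrightarrow> Gamma p"
proof -
  obtain N where N: "\<And>n. N \<le> n \<Longrightarrow> ((\<lambda>s. R n s * s powr (p - 1)) has_integral y n) {0..}"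
    "\<And>n s. N \<le> n \<Longrightarrow> 0 \<le> s \<Longrightarrow> \<bar>R n s\<bar> \<le> C * exp (- b * s)"
    using eventually_conj [OF int dom] unfolding eventually_sequentially by blast
  have "(\<lambda>n. integral {0..} (\<lambda>s. R (n + N) s * s powr (p - 1)))
      \<longlonglongrightarrow> integral {0..} (\<lambda>s. exp (- s) * s powr (p - 1))"
  proof (rule dominated_convergence(2))
    show "(\<lambda>s. R (n + N) s * s powr (p - 1)) integrable_on {0..}" for n
      using N(1) [of "n + N"] by (auto simp: integrable_on_def)
    show "(\<lambda>s. C * (exp (- b * s) * s powr (p - 1))) integrable_on {0..}"
      by (intro integrable_on_mult_right powr_exp_integrable_on p b)
    show "norm (R (n + N) s * s powr (p - 1)) \<le> C * (exp (- b * s) * s powr (p - 1))"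
      if "s \<in> {0..}" for n s
      using N(2) [of "n + N" s] that
      by (simp add: abs_mult mult_right_mono flip: mult.assoc)
    show "(\<lambda>n. R (n + N) s * s powr (p - 1)) \<longlonglongrightarrow> exp (- s) * s powr (p - 1)"
      if "s \<in> {0..}" for s
    \<comment> \<open>At \<open>s = 0\<close> the weight \<open>0 powr (p - 1)\<close> is 0, so
      pointwise convergence for \<open>s > 0\<close> suffices.\<close>
    proof (cases "s = 0")
      case False
      then have "(\<lambda>n. R (n + N) s) \<longlonglongrightarrow> exp (- s)"
        using that lim by (intro LIMSEQ_ignore_initial_segment) auto
      then show ?thesis by (intro tendsto_intros)
    qed simp
  qed
  moreover have "integral {0..} (\<lambda>s. R (n + N) s * s powr (p - 1)) = y (n + N)" for n
    by (intro integral_unique N) simp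
  moreover have "integral {0..} (\<lambda>s. exp (- s) * s powr (p - 1)) = Gamma p"
    using Gamma_integral_real [OF p] by (intro integral_unique) (simp add: exp_minus field_simps)
  ultimately show ?thesis
    by (simp add: LIMSEQ_offset)
qed

section \<open>Chernoff bounds for counts\<close>

context prob_space
begin

text \<open>Markov's inequality for the exponential of \<open>\<theta>\<close> times the count; by
  independence its expectation is a product, and each factor is bounded through
  \<open>1 + x \<le> exp x\<close>. Keeping the factors \<open>\<theta>\<close> and
  \<open>exp \<theta> - 1\<close> in the inequalities covers the upper tail
  (\<open>\<theta> > 0\<close>) and the lower tail (\<open>\<theta> < 0\<close>) at once.\<close>

lemma prob_card_chernoff:
  fixes X :: "'i \<Rightarrow> 'a \<Rightarrow> real" and \<theta> a u :: real
  assumes I: "finite I" and indep: "indep_vars (\<lambda>_. borel) X I" and S: "S \<in> sets borel"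
    and prob: "\<And>i. i \<in> I \<Longrightarrow>
      (exp \<theta> - 1) * prob {\<omega> \<in> space M. X i \<omega> \<in> S} \<le> (exp \<theta> - 1) * u"
  shows "prob {\<omega> \<in> space M. \<theta> * a \<le> \<theta> * real (card {i \<in> I. X i \<omega> \<in> S})}
    \<le> exp (real (card I) * u * (exp \<theta> - 1) - \<theta> * a)"
proof -
  define g where "g y = exp (\<theta> * indicator S y)" for y :: real
  have g: "g \<in> borel_measurable borel"
    using S unfolding g_def by measurable
  have rv [measurable]: "X i \<in> borel_measurable M" if "i \<in> I" for i
    using indep that by (auto simp: indep_vars_def)
  have g_eq: "g y = 1 + (exp \<theta> - 1) * indicator S y" for y
    by (simp add: g_def indicator_def)
  have set: "{\<omega> \<in> space M. X i \<omega> \<in> S} \<in> events" if "i \<in> I" for i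
    using measurable_sets [OF rv [OF that] S] by (simp add: vimage_def Int_def conj_commute)
  have ind_eq: "indicator S (X i \<omega>) = (indicator {\<omega> \<in> space M. X i \<omega> \<in> S} \<omega> :: real)"
    if "\<omega> \<in> space M" for i \<omega>
    using that by (simp add: indicator_def)
  have int_ind: "integrable M (\<lambda>\<omega>. indicator S (X i \<omega>) :: real)" if "i \<in> I" for i
    using set [OF that]
    by (subst Bochner_Integration.integrable_cong [OF refl ind_eq])
       (auto intro!: integrable_real_indicator simp: emeasure_eq_measure)
  have int_g: "integrable M (\<lambda>\<omega>. g (X i \<omega>))" if "i \<in> I" for i
    unfolding g_eq using int_ind [OF that] by simp
  have E_g: "expectation (\<lambda>\<omega>. g (X i \<omega>)) \<le> exp (u * (exp \<theta> - 1))" if "i \<in> I" for i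
  proof -
    have "expectation (\<lambda>\<omega>. indicator S (X i \<omega>) :: real) = prob {\<omega> \<in> space M. X i \<omega> \<in> S}"
      using set [OF that] by (subst Bochner_Integration.integral_cong [OF refl ind_eq]) auto
    then have "expectation (\<lambda>\<omega>. g (X i \<omega>)) = 1 + (exp \<theta> - 1) * prob {\<omega> \<in> space M. X i \<omega> \<in> S}"
      unfolding g_eq using int_ind [OF that] by (simp add: prob_space)
    also have "\<dots> \<le> 1 + u * (exp \<theta> - 1)" using prob [OF that] by (simp add: mult.commute)
    also have "\<dots> \<le> exp (u * (exp \<theta> - 1))" by (rule exp_ge_add_one_self)
    finally show ?thesis .
  qed
  have indep_g: "indep_vars (\<lambda>_. borel) (\<lambda>i \<omega>. g (X i \<omega>)) I"
    using indep g by (rule indep_vars_compose2)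
  have prod_eq: "(\<Prod>i\<in>I. g (X i \<omega>)) = exp (\<theta> * real (card {i \<in> I. X i \<omega> \<in> S}))" for \<omega>
  proof -
    have "(\<Prod>i\<in>I. g (X i \<omega>)) = exp (\<theta> * (\<Sum>i\<in>I. indicator S (X i \<omega>)))"
      unfolding g_def sum_distrib_left exp_sum [OF I] ..
    also have "(\<Sum>i\<in>I. indicator S (X i \<omega>)) = real (card {i \<in> I. X i \<omega> \<in> S})"
      using I by (simp add: indicator_def sum.If_cases Int_def)
    finally show ?thesis .
  qed
  have int: "integrable M (\<lambda>\<omega>. \<Prod>i\<in>I. g (X i \<omega>))"
    using I indep_g int_g by (rule indep_vars_integrable)
  have "prob {\<omega> \<in> space M. \<theta> * a \<le> \<theta> * real (card {i \<in> I. X i \<omega> \<in> S})}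
      = prob {\<omega> \<in> space M. exp (\<theta> * a) \<le> (\<Prod>i\<in>I. g (X i \<omega>))}"
    by (simp add: prod_eq)
  also have "\<dots> \<le> expectation (\<lambda>\<omega>. \<Prod>i\<in>I. g (X i \<omega>)) / exp (\<theta> * a)"
    by (rule integral_Markov_inequality_measure [where A = "{}", OF int])
       (auto simp: g_def intro!: prod_nonneg)
  also have "expectation (\<lambda>\<omega>. \<Prod>i\<in>I. g (X i \<omega>)) = (\<Prod>i\<in>I. expectation (\<lambda>\<omega>. g (X i \<omega>)))"
    using I indep_g int_g by (rule indep_vars_lebesgue_integral)
  also have "\<dots> \<le> (\<Prod>i\<in>I. exp (u * (exp \<theta> - 1)))"
    by (intro prod_mono conjI E_g Bochner_Integration.integral_nonneg) (auto simp: g_def)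
  also have "\<dots> = exp (real (card I) * u * (exp \<theta> - 1))"
    by (simp add: mult.assoc flip: exp_of_nat_mult)
  finally show ?thesis
    by (simp add: exp_diff divide_right_mono)
qed

text \<open>The Chernoff exponent is \<open>- (\<rho> * \<theta> - (exp \<theta> - 1))\<close> times
  the mean bound, and the bracket is positive for small \<open>\<theta> > 0\<close> because
  \<open>\<rho> > 1\<close>. The rate \<open>c\<close> depends on \<open>\<rho>\<close> alone, hence
  is uniform over all grid points used later.\<close>

lemma prob_card_ge:
  fixes \<rho> :: real
  assumes \<rho>: "1 < \<rho>"
  obtains c where "0 < c"
    "\<And>(X :: nat \<Rightarrow> 'a \<Rightarrow> real) I S u. \<lbrakk>finite I; indep_vars (\<lambda>_. borel) X I; S \<in> sets borel;
      \<And>i. i \<in> I \<Longrightarrow> prob {\<omega> \<in> space M. X i \<omega> \<in> S} \<le> u\<rbrakk> \<Longrightarrow>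
      prob {\<omega> \<in> space M. \<rho> * (real (card I) * u) \<le> real (card {i \<in> I. X i \<omega> \<in> S})}
        \<le> exp (- c * (real (card I) * u))"
proof -
  \<comment> \<open>Small enough that \<open>1 / (1 - \<theta>) < \<rho>\<close>; then \<open>exp
    \<theta> \<le> 1 / (1 - \<theta>) = 1 + \<theta> / (1 - \<theta>) < 1 + \<theta> *
    \<rho>\<close>.\<close>
  define \<theta> where "\<theta> = (1 - 1 / \<rho>) / 2"
  have \<theta>: "0 < \<theta>" "\<theta> < 1" "1 < \<rho> * (1 - \<theta>)" using \<rho> by (auto simp: \<theta>_def field_simps)
  have "exp (- \<theta>) \<ge> 1 - \<theta>" using exp_ge_add_one_self [of "- \<theta>"] by simp
  then have "exp \<theta> \<le> 1 / (1 - \<theta>)" using \<theta> by (simp add: exp_minus field_simps)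
  also have "1 / (1 - \<theta>) = 1 + \<theta> * (1 / (1 - \<theta>))" using \<theta> by (simp add: field_simps)
  also have "\<dots> < 1 + \<theta> * \<rho>"
    using \<theta> by (intro add_strict_left_mono mult_strict_left_mono) (auto simp: field_simps)
  finally have c: "0 < \<rho> * \<theta> - (exp \<theta> - 1)" by (simp add: mult.commute)
  show thesis
  proof (rule that [OF c])
    fix X :: "nat \<Rightarrow> 'a \<Rightarrow> real" and I S u
    assume *: "finite I" "indep_vars (\<lambda>_. borel) X I" "S \<in> sets borel"
      "\<And>i. i \<in> I \<Longrightarrow> prob {\<omega> \<in> space M. X i \<omega> \<in> S} \<le> u"
    have "(exp \<theta> - 1) * prob {\<omega> \<in> space M. X i \<omega> \<in> S} \<le> (exp \<theta> - 1) * u"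
      if "i \<in> I" for i
      using *(4) [OF that] \<theta> by (intro mult_left_mono) auto
    from prob_card_chernoff [OF *(1-3) this, of "\<rho> * (real (card I) * u)"]
    show "prob {\<omega> \<in> space M. \<rho> * (real (card I) * u) \<le> real (card {i \<in> I. X i \<omega> \<in> S})}
        \<le> exp (- (\<rho> * \<theta> - (exp \<theta> - 1)) * (real (card I) * u))"
      unfolding mult_le_cancel_left_pos [OF \<theta>(1)] by (simp add: algebra_simps)
  qed
qed

lemma prob_card_le:
  fixes \<rho> :: real
  assumes \<rho>: "1 < \<rho>"
  obtains c where "0 < c"
    "\<And>(X :: nat \<Rightarrow> 'a \<Rightarrow> real) I S u. \<lbrakk>finite I; indep_vars (\<lambda>_. borel) X I; S \<in> sets borel;
      \<And>i. i \<in> I \<Longrightarrow> u \<le> prob {\<omega> \<in> space M. X i \<omega> \<in> S}\<rbrakk> \<Longrightarrow>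
      prob {\<omega> \<in> space M. real (card {i \<in> I. X i \<omega> \<in> S}) \<le> real (card I) * u / \<rho>}
        \<le> exp (- c * (real (card I) * u))"
proof -
  \<comment> \<open>The Chernoff bound is used with parameter \<open>- \<theta>\<close>. From
    \<open>1 + \<theta> < \<rho>\<close> one gets \<open>exp (- \<theta>) \<le> 1 - \<theta> / (1 +
    \<theta>) < 1 - \<theta> / \<rho>\<close>, so the rate is positive.\<close>
  define \<theta> where "\<theta> = (\<rho> - 1) / 2"
  have \<theta>: "0 < \<theta>" "1 + \<theta> < \<rho>" using \<rho> by (auto simp: \<theta>_def field_simps)
  have neg: "- \<theta> < 0" using \<theta> by simp
  have "exp (- \<theta>) \<le> 1 / (1 + \<theta>)"
    using exp_ge_add_one_self [of \<theta>] \<theta> by (simp add: exp_minus field_simps)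
  also have "1 / (1 + \<theta>) = 1 - \<theta> * (1 / (1 + \<theta>))" using \<theta> by (simp add: field_simps)
  also have "\<dots> < 1 - \<theta> * (1 / \<rho>)"
    using \<theta> by (intro diff_strict_left_mono mult_strict_left_mono) (auto simp: field_simps)
  finally have c: "0 < 1 - exp (- \<theta>) - \<theta> / \<rho>" by simp
  show thesis
  proof (rule that [OF c])
    fix X :: "nat \<Rightarrow> 'a \<Rightarrow> real" and I S u
    assume *: "finite I" "indep_vars (\<lambda>_. borel) X I" "S \<in> sets borel"
      "\<And>i. i \<in> I \<Longrightarrow> u \<le> prob {\<omega> \<in> space M. X i \<omega> \<in> S}"
    have "(exp (- \<theta>) - 1) * prob {\<omega> \<in> space M. X i \<omega> \<in> S} \<le> (exp (- \<theta>) - 1) * u"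
      if "i \<in> I" for i
      using *(4) [OF that] \<theta> by (intro mult_left_mono_neg) auto
    from prob_card_chernoff [OF *(1-3) this, of "real (card I) * u / \<rho>"]
    show "prob {\<omega> \<in> space M. real (card {i \<in> I. X i \<omega> \<in> S}) \<le> real (card I) * u / \<rho>}
        \<le> exp (- (1 - exp (- \<theta>) - \<theta> / \<rho>) * (real (card I) * u))"
      unfolding mult_le_cancel_left_neg [OF neg] by (simp add: algebra_simps)
  qed
qed

end

section \<open>Almost sure bounds for tail counts of an iid sample\<close>

text \<open>The floor is the index of the geometric block containing \<open>n\<close>; its
  divergence transfers statements about all late blocks to all large \<open>n\<close>.\<close>

lemma filterlim_nat_floor_log:
  fixes r :: real
  assumes r: "1 < r"
  shows "filterlim (\<lambda>n. nat \<lfloor>log r (real n)\<rfloor>) sequentially sequentially"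
  unfolding filterlim_at_top
proof
  fix Z :: nat
  obtain N :: nat where N: "r ^ Z \<le> N" using real_arch_simple by blast
  show "\<forall>\<^sub>F n in sequentially. Z \<le> nat \<lfloor>log r (real n)\<rfloor>"
    using eventually_ge_at_top [of "max 1 N"]
  proof eventually_elim
    case (elim n)
    then have "r powr real Z \<le> real n" using N r by (simp add: powr_realpow)
    then have "real Z \<le> log r (real n)" using elim r by (simp add: le_log_iff)
    then show ?case by (simp add: le_nat_iff le_floor_iff)
  qed
qed

text \<open>The limits of a distribution function make the defining set nonempty and bounded below,
  and right continuity puts its infimum into the set.\<close>

lemma quantile_galois:
  assumes F: "F = cdf \<mu>" and "real_distribution \<mu>" and s: "0 < s" "s < 1"
  shows "quantile F s \<le> x \<longleftrightarrow> s \<le> F x"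
proof -
  interpret real_distribution \<mu> by fact
  let ?A = "{x. s \<le> F x}"
  have "eventually (\<lambda>x. s < F x) at_top"
    using cdf_lim_at_top_prob s unfolding F by (intro order_tendstoD) auto
  then have ne: "?A \<noteq> {}"
    by (force simp: eventually_at_top_linorder intro: less_imp_le)
  have "eventually (\<lambda>x. F x < s) at_bot"
    using cdf_lim_at_bot s unfolding F by (intro order_tendstoD) auto
  then obtain b where b: "\<And>x. x \<le> b \<Longrightarrow> F x < s"
    unfolding eventually_at_bot_linorder by blast
  have bdd: "bdd_below ?A"
  proof (rule bdd_belowI [of _ b])
    fix x assume "x \<in> ?A"
    then show "b \<le> x" using b [of x] by (cases "x \<le> b") auto
  qed
  have mono: "F x \<le> F y" if "x \<le> y" for x y
    using cdf_nondecreasing [OF that] by (simp add: F)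
  have "s \<le> F (Inf ?A)"
  proof (rule tendsto_lowerbound)
    show "(F \<longlongrightarrow> F (Inf ?A)) (at_right (Inf ?A))"
      using cdf_is_right_cont [of "Inf ?A"] by (simp add: F continuous_within)
    show "\<forall>\<^sub>F x in at_right (Inf ?A). s \<le> F x"
      unfolding eventually_at_right_field
    proof (intro exI [of _ "Inf ?A + 1"] conjI allI impI)
      fix y assume "Inf ?A < y"
      then obtain x where "x \<in> ?A" "x < y" using cInf_lessD [OF ne] by blast
      then show "s \<le> F y" using mono [of x y] by auto
    qed simp
  qed simp
  then show ?thesis
    unfolding quantile_def using mono [of "Inf ?A" x] cInf_lower [OF _ bdd, of x] by auto
qed

definition tail_quantile :: "(real \<Rightarrow> real) \<Rightarrow> real \<Rightarrow> real" where
  "tail_quantile F u = quantile F (1 - u)"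

locale iid_sample = prob_space +
  fixes X :: "nat \<Rightarrow> 'a \<Rightarrow> real" and F :: "real \<Rightarrow> real"
  assumes indep_X: "indep_vars (\<lambda>_. borel) X {1..}"
    and cdf_X: "1 \<le> i \<Longrightarrow> cdf (distr M borel (X i)) = F"
begin

abbreviation q :: "real \<Rightarrow> real" where
  "q \<equiv> tail_quantile F"

lemma X_measurable [measurable]: "1 \<le> i \<Longrightarrow> X i \<in> borel_measurable M"
  using indep_X by (auto simp: indep_vars_def)

lemma tail_quantile_le_iff:
  assumes "0 < u" "u < 1"
  shows "q u \<le> x \<longleftrightarrow> 1 - u \<le> F x"
  unfolding tail_quantile_def
proof (rule quantile_galois)
  show "F = cdf (distr M borel (X 1))" by (simp add: cdf_X)
  show "real_distribution (distr M borel (X 1))" by (intro real_distribution_distr) simp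
qed (use assms in auto)

lemma tail_quantile_antimono:
  assumes "0 < u" "u \<le> v" "v < 1"
  shows "q v \<le> q u"
proof -
  have "1 - u \<le> F (q u)" using tail_quantile_le_iff [of u "q u"] assms by simp
  then show ?thesis using tail_quantile_le_iff [of v "q u"] assms by simp
qed

lemma F_eq_prob:
  assumes "1 \<le> i"
  shows "F x = prob {\<omega> \<in> space M. X i \<omega> \<le> x}"
proof -
  have "F x = measure (distr M borel (X i)) {..x}"
    using cdf_X [OF assms] by (auto simp: cdf_def)
  also have "\<dots> = prob {\<omega> \<in> space M. X i \<omega> \<le> x}"
    using X_measurable [OF assms]
    by (subst measure_distr) (auto intro!: arg_cong [where f = prob])
  finally show ?thesis .
qed

text \<open>An atom at \<open>q u\<close> can make this probability smaller than \<open>u\<close>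
  and that of the weak exceedance larger. Hence upper bounds on counts below concern
  \<open><\<close> and lower bounds concern \<open>\<le>\<close>.\<close>

lemma prob_gt_tail_quantile:
  assumes "1 \<le> i" "0 < u" "u < 1"
  shows "prob {\<omega> \<in> space M. X i \<omega> \<in> {q u<..}} \<le> u"
proof -
  note [measurable] = X_measurable [OF assms(1)]
  have "1 - u \<le> F (q u)" using tail_quantile_le_iff [of u "q u"] assms by simp
  moreover have "prob {\<omega> \<in> space M. X i \<omega> \<in> {q u<..}} = 1 - F (q u)"
    unfolding F_eq_prob [OF assms(1)]
    by (subst prob_compl [symmetric]) (auto intro!: arg_cong [where f = prob])
  ultimately show ?thesis by simp
qed

text \<open>To the left of \<open>q u\<close> the distribution function stays below
  \<open>1 - u\<close>, and so does its left limit, up to equality.\<close>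

lemma prob_ge_tail_quantile:
  assumes "1 \<le> i" "0 < u" "u < 1"
  shows "u \<le> prob {\<omega> \<in> space M. X i \<omega> \<in> {q u..}}"
proof -
  note [measurable] = X_measurable [OF assms(1)]
  interpret D: real_distribution "distr M borel (X i)" by (intro real_distribution_distr) simp
  have "measure (distr M borel (X i)) {..<q u} \<le> 1 - u"
  proof (rule tendsto_upperbound [OF D.cdf_at_left])
    show "\<forall>\<^sub>F x in at_left (q u). cdf (distr M borel (X i)) x \<le> 1 - u"
      unfolding cdf_X [OF assms(1)] eventually_at_left_field
    proof (intro exI [of _ "q u - 1"] conjI allI impI)
      show "F y \<le> 1 - u" if "y < q u" for y
        using tail_quantile_le_iff [OF assms(2,3), of y] that by linarith
    qed simp
  qed simp
  moreover have "measure (distr M borel (X i)) {..<q u} = prob {\<omega> \<in> space M. X i \<omega> < q u}"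
    by (subst measure_distr) (auto intro!: arg_cong [where f = prob])
  moreover have "prob {\<omega> \<in> space M. X i \<omega> \<in> {q u..}} = 1 - prob {\<omega> \<in> space M. X i \<omega> < q u}"
    by (subst prob_compl [symmetric]) (auto intro!: arg_cong [where f = prob])
  ultimately show ?thesis by simp
qed

text \<open>Union bound on dyadic blocks \<open>2 ^ j \<le> n < 2 ^ Suc j\<close> and
  Borel--Cantelli: the \<open>2 ^ Suc j\<close> observations exceed \<open>q (v j)\<close> with
  total probability of order \<open>1 / j^2\<close>.\<close>

lemma AE_eventually_max_le:
  "AE \<omega> in M. \<forall>\<^sub>F n in sequentially. \<forall>u. 0 < u \<and> u < 1 \<and> real n * u * (ln (real n))\<^sup>2 < 1 \<longrightarrow>
     (\<forall>i\<in>{1..n}. X i \<omega> \<le> q u)"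
proof -
  \<comment> \<open>The borderline value of \<open>u\<close> at \<open>n = 2 ^ j\<close>. Division
    by zero gives \<open>v 0 = 0\<close>, which is why \<open>j \<ge> 1\<close> is required
    below.\<close>
  define v where "v j = 1 / (2 ^ j * (real j * ln 2)\<^sup>2)" for j :: nat
  have v_pos: "0 < v j" if "1 \<le> j" for j using that by (simp add: v_def)
  have v_less: "\<forall>\<^sub>F j in sequentially. v j < 1" unfolding v_def by real_asymp
  define E where
    "E j = (if v j < 1 \<and> 1 \<le> j then \<Union>i\<in>{1..2 ^ Suc j}. {\<omega> \<in> space M. X i \<omega> \<in> {q (v j)<..}} else {})"
    for j
  have E_sets: "E j \<in> events" for j
    unfolding E_def by auto
  have prob_E: "prob (E j) \<le> 2 * (1 / (real j * ln 2)\<^sup>2)" for j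
  proof (cases "v j < 1 \<and> 1 \<le> j")
    case True
    have "prob (E j) \<le> (\<Sum>i\<in>{1..2 ^ Suc j}. prob {\<omega> \<in> space M. X i \<omega> \<in> {q (v j)<..}})"
      unfolding E_def using True by (auto intro!: measure_UNION_le)
    also have "\<dots> \<le> (\<Sum>i\<in>{1..(2::nat) ^ Suc j}. v j)"
      using True v_pos by (intro sum_mono prob_gt_tail_quantile) auto
    also have "\<dots> = 2 * (1 / (real j * ln 2)\<^sup>2)"
      by (simp add: v_def)
    finally show ?thesis .
  qed (auto simp: E_def)
  have "summable (\<lambda>j. 2 * (1 / (real j * ln 2)\<^sup>2))"
  proof -
    have "summable (\<lambda>j. 2 / (ln 2)\<^sup>2 * (1 / real j ^ 2))"
      by (intro summable_mult inverse_power_summable [where 'a = real, unfolded inverse_eq_divide]) simp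
    then show ?thesis by (simp add: power_mult_distrib mult.commute)
  qed
  then have "summable (\<lambda>j. prob (E j))"
    by (rule summable_comparison_test' [where N = 0]) (use prob_E in auto)
  then have "AE \<omega> in M. \<forall>\<^sub>F j in sequentially. \<omega> \<in> space M - E j"
    by (intro borel_cantelli_AE1 E_sets) (auto simp: emeasure_eq_measure)
  then show ?thesis
  proof eventually_elim
    case (elim \<omega>)
    define J where "J n = nat \<lfloor>log 2 (real n)\<rfloor>" for n :: nat
    have J_lim: "filterlim J sequentially sequentially" unfolding J_def by (rule filterlim_nat_floor_log) simp
    have "\<forall>\<^sub>F j in sequentially. \<omega> \<in> space M - E j \<and> v j < 1 \<and> 1 \<le> j"
      using elim v_less eventually_ge_at_top [of 1] by eventually_elim auto
    from eventually_compose_filterlim [OF this J_lim] show ?case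
      using eventually_ge_at_top [of 2]
    proof eventually_elim
      case (elim n)
      define j where "j = J n"
      have j: "1 \<le> j" "v j < 1" "\<omega> \<in> space M - E j" using elim by (auto simp: j_def)
      have "0 \<le> log 2 (real n)" using elim by simp
      then have "real j \<le> log 2 (real n)" "log 2 (real n) < real j + 1"
        unfolding j_def J_def by linarith+
      then have n': "2 ^ j \<le> real n" "real n < 2 ^ Suc j"
        using elim by (auto simp: le_log_iff less_log_iff log_less_iff powr_realpow powr_add)
      have "n < 2 ^ Suc j"
        using n'(2) unfolding of_nat_less_numeral_power_cancel_iff .
      moreover have "2 ^ j \<le> n" using n'(1) by simp
      ultimately have n: "2 ^ j \<le> n" "n < 2 ^ Suc j" by auto
      have ln_n: "real j * ln 2 \<le> ln (real n)"
        using \<open>real j \<le> log 2 (real n)\<close> by (simp add: log_def field_simps)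
      show ?case
      proof (intro allI impI ballI)
        fix u i assume u: "0 < u \<and> u < 1 \<and> real n * u * (ln (real n))\<^sup>2 < 1" and i: "i \<in> {1..n}"
        have "2 ^ j * (real j * ln 2)\<^sup>2 \<le> real n * (ln (real n))\<^sup>2"
          using n ln_n by (intro mult_mono power_mono) (auto simp flip: of_nat_le_iff)
        then have "u * (2 ^ j * (real j * ln 2)\<^sup>2) \<le> u * (real n * (ln (real n))\<^sup>2)"
          using u by (intro mult_left_mono) auto
        also have "\<dots> < 1" using u by (simp add: ac_simps)
        finally have "u \<le> v j"
          using j by (simp add: v_def field_simps)
        then have "q (v j) \<le> q u" using u j by (intro tail_quantile_antimono) auto
        moreover have "X i \<omega> \<le> q (v j)" using j i n by (auto simp: E_def not_less)
        ultimately show "X i \<omega> \<le> q u" by simp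
      qed
    qed
  qed
qed

text \<open>Since \<open>N j\<close> is about \<open>r ^ j\<close>, a power of \<open>j\<close>
  stands for a power of the logarithm of the sample size. Block \<open>j\<close> involves at most
  \<open>j\<close> levels, each failing with probability at most
  \<open>2 * exp (- c * j powr \<eta>)\<close>, and these bounds are summable.\<close>

lemma AE_eventually_grid:
  fixes r d \<eta> :: real
  assumes r: "1 < r" and d: "0 < d" and \<eta>: "0 < \<eta>"
  defines "N \<equiv> \<lambda>j. nat \<lfloor>r ^ j\<rfloor>" and "u \<equiv> \<lambda>m::nat. 1 / r ^ m"
  shows "AE \<omega> in M. \<forall>\<^sub>F j in sequentially. \<forall>m\<ge>1. d * real j powr \<eta> \<le> real (N j) * u m \<longrightarrow>
    real (card {i \<in> {1..N j}. q (u m) < X i \<omega>}) < r * (real (N j) * u m) \<and>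
    real (N j) * u m / r < real (card {i \<in> {1..N j}. q (u m) \<le> X i \<omega>})"
proof -
  obtain c1 where c1: "0 < c1" and ge:
    "\<And>(X :: nat \<Rightarrow> 'a \<Rightarrow> real) I S u. \<lbrakk>finite I; indep_vars (\<lambda>_. borel) X I; S \<in> sets borel;
      \<And>i. i \<in> I \<Longrightarrow> prob {\<omega> \<in> space M. X i \<omega> \<in> S} \<le> u\<rbrakk> \<Longrightarrow>
      prob {\<omega> \<in> space M. r * (real (card I) * u) \<le> real (card {i \<in> I. X i \<omega> \<in> S})}
        \<le> exp (- c1 * (real (card I) * u))"
    by (fact prob_card_ge [OF r])
  obtain c2 where c2: "0 < c2" and le:
    "\<And>(X :: nat \<Rightarrow> 'a \<Rightarrow> real) I S u. \<lbrakk>finite I; indep_vars (\<lambda>_. borel) X I; S \<in> sets borel;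
      \<And>i. i \<in> I \<Longrightarrow> u \<le> prob {\<omega> \<in> space M. X i \<omega> \<in> S}\<rbrakk> \<Longrightarrow>
      prob {\<omega> \<in> space M. real (card {i \<in> I. X i \<omega> \<in> S}) \<le> real (card I) * u / r}
        \<le> exp (- c2 * (real (card I) * u))"
    by (fact prob_card_le [OF r])
  \<comment> \<open>The relevant means are at least \<open>d * j powr \<eta>\<close>, so this rate
    serves both tails.\<close>
  define c where "c = min c1 c2 * d"
  have c: "0 < c" using c1 c2 d by (simp add: c_def)
  define U where "U j m = {\<omega> \<in> space M. r * (real (card {1..N j}) * u m)
      \<le> real (card {i \<in> {1..N j}. X i \<omega> \<in> {q (u m)<..}})}" for j m
  define L where "L j m = {\<omega> \<in> space M. real (card {i \<in> {1..N j}. X i \<omega> \<in> {q (u m)..}})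
      \<le> real (card {1..N j}) * u m / r}" for j m
  have u: "0 < u m" "1 \<le> m \<Longrightarrow> u m < 1" for m
    using r by (auto simp: u_def power_gt1_lemma one_less_power)
  have meas: "(\<lambda>\<omega>. real (card {i \<in> {1..N j}. X i \<omega> \<in> A})) \<in> borel_measurable M"
    if A: "A \<in> sets borel" for A j
  proof -
    have eq: "real (card {i \<in> {1..N j}. X i \<omega> \<in> A}) = (\<Sum>i\<in>{1..N j}. indicator A (X i \<omega>))"
      for \<omega> by (simp add: indicator_def sum.If_cases Int_def)
    show ?thesis
      unfolding eq
      by (intro borel_measurable_sum measurable_compose [OF X_measurable borel_measurable_indicator])
         (use A in auto)
  qed
  have U_L_sets: "U j m \<in> events" "L j m \<in> events" for j m
    unfolding U_def L_def
    by (rule borel_measurable_le [OF borel_measurable_const meas], simp,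
        rule borel_measurable_le [OF meas borel_measurable_const], simp)
  have indep: "indep_vars (\<lambda>_. borel) X {1..N j}" for j
    by (rule indep_vars_subset [OF indep_X]) auto
  have decay: "exp (- c' * (real (N j) * u m)) \<le> exp (- c * real j powr \<eta>)"
    if "d * real j powr \<eta> \<le> real (N j) * u m" "min c1 c2 \<le> c'" for j m c'
  proof -
    have "min c1 c2 * (d * real j powr \<eta>) \<le> c' * (real (N j) * u m)"
      using c1 c2 d that by (intro mult_mono [OF that(2,1)]) auto
    then show ?thesis by (simp add: c_def mult.assoc)
  qed
  have prob_U: "prob (U j m) \<le> exp (- c * real j powr \<eta>)"
    if "1 \<le> m" "d * real j powr \<eta> \<le> real (N j) * u m" for j m
  proof -
    have "prob (U j m) \<le> exp (- c1 * (real (card {1..N j}) * u m))"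
      unfolding U_def by (rule ge [OF _ indep]) (use prob_gt_tail_quantile u that in auto)
    also have "\<dots> \<le> exp (- c * real j powr \<eta>)"
      using decay [OF that(2), of c1] by simp
    finally show ?thesis .
  qed
  have prob_L: "prob (L j m) \<le> exp (- c * real j powr \<eta>)"
    if "1 \<le> m" "d * real j powr \<eta> \<le> real (N j) * u m" for j m
  proof -
    have "prob (L j m) \<le> exp (- c2 * (real (card {1..N j}) * u m))"
      unfolding L_def by (rule le [OF _ indep]) (use prob_ge_tail_quantile u that in auto)
    also have "\<dots> \<le> exp (- c * real j powr \<eta>)"
      using decay [OF that(2), of c2] by simp
    finally show ?thesis .
  qed
  \<comment> \<open>The restriction to \<open>m \<le> j\<close> loses nothing for large
    \<open>j\<close>: once \<open>d * j powr \<eta> \<ge> 1\<close>, a mean \<open>N j * u m\<close>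
    above it forces \<open>r ^ m \<le> N j \<le> r ^ j\<close>.\<close>
  define G where "G j = {m \<in> {1..j}. d * real j powr \<eta> \<le> real (N j) * u m}" for j
  define E where "E j = (\<Union>m\<in>G j. U j m \<union> L j m)" for j
  have fin: "finite (G j)" for j by (simp add: G_def)
  have E_sets: "E j \<in> events" for j using fin U_L_sets unfolding E_def by (intro sets.finite_UN sets.Un)
  have prob_E: "prob (E j) \<le> real j * (2 * exp (- c * real j powr \<eta>))" for j
  proof -
    have "prob (E j) \<le> (\<Sum>m\<in>G j. prob (U j m \<union> L j m))"
      unfolding E_def using fin U_L_sets by (intro measure_UNION_le sets.Un)
    also have "\<dots> \<le> (\<Sum>m\<in>G j. 2 * exp (- c * real j powr \<eta>))"
    proof (rule sum_mono)
      fix m assume "m \<in> G j"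
      then have "prob (U j m) \<le> exp (- c * real j powr \<eta>)" "prob (L j m) \<le> exp (- c * real j powr \<eta>)"
        using prob_U prob_L by (auto simp: G_def)
      then show "prob (U j m \<union> L j m) \<le> 2 * exp (- c * real j powr \<eta>)"
        using measure_Un_le [OF U_L_sets, of j m j m] by linarith
    qed
    also have "\<dots> \<le> real j * (2 * exp (- c * real j powr \<eta>))"
    proof -
      have "card (G j) \<le> card {1..j}" unfolding G_def by (intro card_mono) auto
      then show ?thesis by (simp add: mult_right_mono)
    qed
    finally show ?thesis .
  qed
  \<comment> \<open>One factor \<open>j\<close> counts the levels, and \<open>j^2\<close> prepares
    the comparison with \<open>1 / j^2\<close>.\<close>
  have "((\<lambda>j. real j * (2 * exp (- c * real j powr \<eta>)) * real j ^ 2) \<longlonglongrightarrow> 0)"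
    using c \<eta> by real_asymp
  then have "\<forall>\<^sub>F j in sequentially. real j * (2 * exp (- c * real j powr \<eta>)) * real j ^ 2 < 1"
    by (rule order_tendstoD) simp
  then have "\<forall>\<^sub>F j in sequentially. norm (prob (E j)) \<le> 1 / real j ^ 2"
    using eventually_gt_at_top [of 0]
  proof eventually_elim
    case (elim j)
    then have "real j * (2 * exp (- c * real j powr \<eta>)) \<le> 1 / real j ^ 2"
      by (simp add: field_simps)
    then show ?case using prob_E [of j] by simp
  qed
  then have "summable (\<lambda>j. prob (E j))"
    by (rule summable_comparison_test_ev)
       (intro inverse_power_summable [where 'a = real, unfolded inverse_eq_divide], simp)
  then have "AE \<omega> in M. \<forall>\<^sub>F j in sequentially. \<omega> \<in> space M - E j"
    by (intro borel_cantelli_AE1 E_sets) (auto simp: emeasure_eq_measure)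
  then show ?thesis
  proof eventually_elim
    case (elim \<omega>)
    have "filterlim (\<lambda>j. d * real j powr \<eta>) at_top sequentially"
      using d \<eta> by real_asymp
    then have "\<forall>\<^sub>F j in sequentially. 1 \<le> d * real j powr \<eta>"
      by (simp add: filterlim_at_top)
    with elim show ?case
    proof eventually_elim
      case (elim j)
      show ?case
      proof (intro allI impI)
        fix m :: nat assume m: "1 \<le> m" "d * real j powr \<eta> \<le> real (N j) * u m"
        have "1 \<le> real (N j) * u m" using elim m by linarith
        then have "r ^ m \<le> real (N j)" using r by (simp add: u_def field_simps)
        also have "real (N j) \<le> r ^ j" using r by (simp add: N_def)
        finally have "m \<le> j" using r by simp
        then have "m \<in> G j" using m by (simp add: G_def)
        then show "real (card {i \<in> {1..N j}. q (u m) < X i \<omega>}) < r * (real (N j) * u m) \<and>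
            real (N j) * u m / r < real (card {i \<in> {1..N j}. q (u m) \<le> X i \<omega>})"
          using elim by (auto simp: E_def U_def L_def not_le)
      qed
    qed
  qed
qed

text \<open>Interpolation from the grid: counts increase with the sample size and with
  \<open>u\<close>, so each pair \<open>(n, u)\<close> is enclosed between neighbouring grid points,
  at the cost of a few factors \<open>r\<close>.\<close>

lemma AE_eventually_count_bounds:
  fixes \<rho> \<eta> :: real
  assumes \<rho>: "1 < \<rho>" "\<rho> \<le> 2" and \<eta>: "0 < \<eta>"
  shows "AE \<omega> in M. \<forall>\<^sub>F n in sequentially. \<forall>u. 0 < u \<and> u < 1 / 2 \<and> ln (real n) powr \<eta> \<le> real n * u \<longrightarrow>
    real (card {i \<in> {1..n}. q u < X i \<omega>}) \<le> \<rho> * (real n * u) \<and>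
    real n * u / \<rho> \<le> real (card {i \<in> {1..n}. q u \<le> X i \<omega>})"
proof -
  \<comment> \<open>The upper bound loses \<open>r\<close> three times: sample size, level, Chernoff
    bound. The lower bound loses it once more, to the floor in \<open>N j\<close>.\<close>
  define r where "r = \<rho> powr (1 / 4)"
  have r4: "r ^ 4 = \<rho>" using \<rho> by (simp add: r_def powr_power)
  have r: "1 < r" using \<rho> by (simp add: r_def)
  have r_le: "r \<le> \<rho>" "r ^ 3 \<le> \<rho>"
    using power_increasing [of 1 4 r] power_increasing [of 3 4 r] r r4 by auto
  \<comment> \<open>\<open>ln r / 2\<close> comes from \<open>Suc j \<le> 2 * j\<close> and
    \<open>j * ln r \<le> ln n\<close>; \<open>r ^ 3\<close> compensates for passing from
    \<open>n * u\<close> to the smaller mean \<open>N j * v (Suc m)\<close>.\<close>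
  define d where "d = (ln r / 2) powr \<eta> / r ^ 3"
  have d: "0 < d" using r by (simp add: d_def)
  define N where "N j = nat \<lfloor>r ^ j\<rfloor>" for j
  define v where "v m = 1 / r ^ m" for m :: nat
  define P where "P \<omega> j \<longleftrightarrow> (\<forall>m\<ge>1. d * real j powr \<eta> \<le> real (N j) * v m \<longrightarrow>
    real (card {i \<in> {1..N j}. q (v m) < X i \<omega>}) < r * (real (N j) * v m) \<and>
    real (N j) * v m / r < real (card {i \<in> {1..N j}. q (v m) \<le> X i \<omega>}))" for \<omega> j
  have "AE \<omega> in M. \<forall>\<^sub>F j in sequentially. P \<omega> j"
    unfolding P_def N_def v_def by (rule AE_eventually_grid [OF r d \<eta>])
  then show ?thesis
  proof eventually_elim
    case (elim \<omega>)
    define J where "J n = nat \<lfloor>log r (real n)\<rfloor>" for n :: nat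
    have J_lim: "filterlim J sequentially sequentially" unfolding J_def using r by (rule filterlim_nat_floor_log)
    \<comment> \<open>The inequality prepared here says \<open>r ^ j \<le> r * (r ^ j - 1)\<close>,
      so rounding \<open>r ^ j\<close> down costs at most one factor \<open>r\<close>.\<close>
    obtain j0 where j0: "r / (r - 1) < r ^ j0" using real_arch_pow [OF r] by blast
    have "\<forall>\<^sub>F j in sequentially. r \<le> r ^ j * (r - 1)"
      using eventually_ge_at_top [of j0]
    proof eventually_elim
      case (elim j)
      then have "r / (r - 1) < r ^ j" using j0 r power_increasing [of j0 j r] by linarith
      then show ?case using r by (simp add: field_simps)
    qed
    moreover have "\<forall>\<^sub>F j in sequentially. P \<omega> (Suc j)"
      using elim by (simp only: eventually_sequentially_Suc)
    ultimately have "\<forall>\<^sub>F j in sequentially. P \<omega> j \<and> P \<omega> (Suc j) \<and> r \<le> r ^ j * (r - 1) \<and> 1 \<le> j"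
      using elim eventually_ge_at_top [of 1] by eventually_elim auto
    from eventually_compose_filterlim [OF this J_lim] show ?case
      using eventually_ge_at_top [of 2]
    proof eventually_elim
      case (elim n)
      define j where "j = J n"
      have j: "P \<omega> j" "P \<omega> (Suc j)" "r \<le> r ^ j * (r - 1)" "1 \<le> j" using elim by (auto simp: j_def)
      have "0 \<le> log r (real n)" using elim r by simp
      then have "real j \<le> log r (real n)" "log r (real n) < real (Suc j)"
        unfolding j_def J_def by linarith+
      then have n: "r ^ j \<le> n" "n < r ^ Suc j"
        using elim r by (auto simp: le_log_iff log_less_iff powr_realpow simp del: power_Suc of_nat_Suc)
      have ln_n: "real j * ln r \<le> ln (real n)"
        using \<open>real j \<le> log r (real n)\<close> r by (simp add: log_def field_simps)
      have N_le: "real (N i) \<le> r ^ i" for i using r by (simp add: N_def)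
      have Nj: "N j \<le> n" using N_le [of j] n by (simp flip: of_nat_le_iff)
      have NSj: "n \<le> N (Suc j)" using n(2) r by (simp add: N_def le_nat_iff le_floor_iff del: power_Suc)
      have r_N: "r ^ j \<le> r * real (N j)"
      proof -
        have "r ^ j - 1 \<le> real (N j)" unfolding N_def by linarith
        then have "r * (r ^ j - 1) \<le> r * real (N j)" using r by (intro mult_left_mono) auto
        then show ?thesis using j(3) by (simp add: algebra_simps)
      qed
      have "r * r ^ j \<le> r * (r * real (N j))"
        using r r_N by (intro mult_left_mono) auto
      then have n_le_N: "real n \<le> r ^ 2 * real (N j)"
        using n(2) unfolding power_Suc power2_eq_square mult.assoc by linarith
      have "r * r ^ j \<le> r * real n" using n(1) r by (intro mult_left_mono) auto
      then have NSj_le: "real (N (Suc j)) \<le> r * real n"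
        using N_le [of "Suc j"] unfolding power_Suc by linarith
      show ?case
      proof (intro allI impI)
        fix u assume u: "0 < u \<and> u < 1 / 2 \<and> ln (real n) powr \<eta> \<le> real n * u"
        \<comment> \<open>Chosen so that \<open>v (Suc m) \<le> u \<le> v m\<close>. As
          \<open>r \<le> 2\<close> and \<open>u < 1 / 2\<close>, one has \<open>m \<ge> 1\<close>,
          which the grid bounds need.\<close>
        define m where "m = nat \<lfloor>log r (1 / u)\<rfloor>"
        have "r * u \<le> 2 * u" using u r_le \<rho> by (intro mult_right_mono) auto
        then have "r * u < 1" using u by linarith
        then have "r < 1 / u" using u by (simp add: field_simps)
        then have ge1: "1 \<le> log r (1 / u)" using r u by (simp add: le_log_iff)
        then have "real m \<le> log r (1 / u)" "log r (1 / u) < real (Suc m)"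
          unfolding m_def by linarith+
        then have m: "r ^ m \<le> 1 / u" "1 / u < r ^ Suc m"
          using u r by (auto simp: le_log_iff log_less_iff powr_realpow simp del: power_Suc of_nat_Suc)
        have m1: "1 \<le> m" using ge1 unfolding m_def by (simp add: le_nat_iff le_floor_iff)
        have vm: "u \<le> v m" "v m \<le> r * u" "v m < 1"
          using m u r m1 by (auto simp: v_def field_simps one_less_power)
        have vS: "v (Suc m) \<le> u" "u \<le> r * v (Suc m)" "0 < v (Suc m)"
          using m u r by (auto simp: v_def field_simps)
        have "real (Suc j) * (ln r / 2) = real (Suc j) / 2 * ln r" by simp
        also have "\<dots> \<le> real j * ln r" using j r by (intro mult_right_mono) auto
        finally have "real (Suc j) * (ln r / 2) \<le> ln (real n)" using ln_n by linarith
        then have "(real (Suc j) * (ln r / 2)) powr \<eta> \<le> ln (real n) powr \<eta>"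
          using r \<eta> by (intro powr_mono2) auto
        moreover have "r ^ 3 * (d * real (Suc j) powr \<eta>) = (real (Suc j) * (ln r / 2)) powr \<eta>"
          using r by (subst powr_mult) (auto simp: d_def)
        ultimately have dS: "r ^ 3 * (d * real (Suc j) powr \<eta>) \<le> real n * u"
          using u by linarith
        have dj: "r ^ 3 * (d * real j powr \<eta>) \<le> real n * u"
        proof -
          have d_le: "d * real j powr \<eta> \<le> d * real (Suc j) powr \<eta>"
            using d \<eta> by (intro mult_left_mono powr_mono2) auto
          have "r ^ 3 * (d * real j powr \<eta>) \<le> r ^ 3 * (d * real (Suc j) powr \<eta>)"
            by (rule mult_left_mono [OF d_le]) (use r in simp)
          then show ?thesis using dS by linarith
        qed
        have "1 * (d * real (Suc j) powr \<eta>) \<le> r ^ 3 * (d * real (Suc j) powr \<eta>)"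
          using r d by (intro mult_right_mono) auto
        also have "\<dots> \<le> real n * u" by (rule dS)
        also have "\<dots> \<le> real (N (Suc j)) * v m" using NSj vm u by (intro mult_mono) auto
        finally have "real (card {i \<in> {1..N (Suc j)}. q (v m) < X i \<omega>}) < r * (real (N (Suc j)) * v m)"
          using j(2) m1 by (simp add: P_def)
        moreover have "card {i \<in> {1..n}. q u < X i \<omega>} \<le> card {i \<in> {1..N (Suc j)}. q (v m) < X i \<omega>}"
          using tail_quantile_antimono [of u "v m"] vm u NSj by (intro card_mono) auto
        moreover have "r * (real (N (Suc j)) * v m) \<le> \<rho> * (real n * u)"
        proof -
          have "r * (real (N (Suc j)) * v m) \<le> r * ((r * real n) * (r * u))"
            using NSj_le vm r u by (intro mult_left_mono mult_mono) auto
          also have "\<dots> = r ^ 3 * (real n * u)" by (simp add: power3_eq_cube)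
          also have "\<dots> \<le> \<rho> * (real n * u)" using r_le u by (intro mult_right_mono) auto
          finally show ?thesis .
        qed
        ultimately have upper: "real (card {i \<in> {1..n}. q u < X i \<omega>}) \<le> \<rho> * (real n * u)"
          by linarith
        have nu: "real n * u \<le> r ^ 3 * (real (N j) * v (Suc m))"
        proof -
          have "real n * u \<le> (r ^ 2 * real (N j)) * (r * v (Suc m))"
            using n_le_N vS u r by (intro mult_mono) auto
          also have "\<dots> = r ^ 3 * (real (N j) * v (Suc m))"
            by (simp add: power2_eq_square power3_eq_cube)
          finally show ?thesis .
        qed
        with dj have "r ^ 3 * (d * real j powr \<eta>) \<le> r ^ 3 * (real (N j) * v (Suc m))"
          by (rule order_trans)
        then have "d * real j powr \<eta> \<le> real (N j) * v (Suc m)"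
          using r by simp
        then have "real (N j) * v (Suc m) / r < real (card {i \<in> {1..N j}. q (v (Suc m)) \<le> X i \<omega>})"
          using j(1) by (simp add: P_def)
        moreover have "card {i \<in> {1..N j}. q (v (Suc m)) \<le> X i \<omega>} \<le> card {i \<in> {1..n}. q u \<le> X i \<omega>}"
          using tail_quantile_antimono [of "v (Suc m)" u] vS u Nj by (intro card_mono) auto
        moreover have "real n * u / \<rho> \<le> real (N j) * v (Suc m) / r"
          using nu r by (simp add: r4 [symmetric] field_simps eval_nat_numeral)
        ultimately show "real (card {i \<in> {1..n}. q u < X i \<omega>}) \<le> \<rho> * (real n * u) \<and>
            real n * u / \<rho> \<le> real (card {i \<in> {1..n}. q u \<le> X i \<omega>})"
          using upper by linarith
      qed
    qed
  qed
qed

end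

section \<open>Almost sure convergence\<close>

text \<open>Deterministic statement for one fixed sample path: all probability has gone into
  \<open>count\<close> and \<open>max_le\<close>. The exponent \<open>\<delta> / 2\<close> in
  \<open>count\<close>, against \<open>\<delta>\<close> in \<open>k_large\<close>, leaves the room
  needed for the integrable majorant.\<close>

lemma S_stat_tendsto:
  fixes X :: "nat \<Rightarrow> 'a \<Rightarrow> real" and q :: "real \<Rightarrow> real" and k :: "nat \<Rightarrow> nat" and \<gamma> p \<delta> :: real
  assumes \<gamma>: "0 < \<gamma>" and p: "0 < p" and \<delta>: "0 < \<delta>"
    and q_ratio: "\<And>c. 0 < c \<Longrightarrow> ((\<lambda>s. q (c * s) / q s) \<longlongrightarrow> c powr (- \<gamma>)) (at_right 0)"
    and q_pos: "\<forall>\<^sub>F s in at_right 0. 0 < q s"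
    and q_antimono: "\<And>u v. 0 < u \<Longrightarrow> u \<le> v \<Longrightarrow> v < 1 \<Longrightarrow> q v \<le> q u"
    and k_lim: "filterlim k at_top sequentially"
    and k_small: "(\<lambda>n. real (k n) / real n) \<longlonglongrightarrow> 0"
    and k_large: "(\<lambda>n. ln (real n) powr \<delta> / real (k n)) \<longlonglongrightarrow> 0"
    and count: "\<And>\<rho>. 1 < \<rho> \<Longrightarrow> \<rho> \<le> 2 \<Longrightarrow> \<forall>\<^sub>F n in sequentially. \<forall>u.
      0 < u \<and> u < 1 / 2 \<and> ln (real n) powr (\<delta> / 2) \<le> real n * u \<longrightarrow>
      real (card {i \<in> {1..n}. q u < X i \<omega>}) \<le> \<rho> * (real n * u) \<and>
      real n * u / \<rho> \<le> real (card {i \<in> {1..n}. q u \<le> X i \<omega>})"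
    and max_le: "\<forall>\<^sub>F n in sequentially. \<forall>u. 0 < u \<and> u < 1 \<and> real n * u * (ln (real n))\<^sup>2 < 1 \<longrightarrow>
      (\<forall>i\<in>{1..n}. X i \<omega> \<le> q u)"
  shows "(\<lambda>n. S_stat X k p n \<omega>) \<longlonglongrightarrow> \<gamma> powr p * Gamma (p + 1)"
proof -

  \<comment> \<open>Notation and elementary asymptotics\<close>
  define T where "T n = order_statistic X n (n - k n) \<omega>" for n
  define w where "w n = real (k n) / real n" for n
  define N where "N n y = real (card {i \<in> {1..n}. y < X i \<omega>})" for n y
  define N' where "N' n y = real (card {i \<in> {1..n}. y \<le> X i \<omega>})" for n y
  have N_antimono: "N n y \<le> N n x" if "x \<le> y" for n x y
    using that by (auto simp: N_def intro!: card_mono)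
  have N'_le: "N' n x \<le> N n y" if "y < x" for n x y
    using that by (auto simp: N_def N'_def intro!: card_mono)
  have k_range: "\<forall>\<^sub>F n in sequentially. 1 \<le> k n \<and> k n < n"
  proof -
    have "\<forall>\<^sub>F n in sequentially. 1 \<le> k n" using k_lim by (auto simp: filterlim_at_top)
    moreover have "\<forall>\<^sub>F n in sequentially. real (k n) / real n < 1"
      using k_small by (rule order_tendstoD) simp
    ultimately show ?thesis
      using eventually_gt_at_top [of 0] by eventually_elim (auto simp: field_simps)
  qed
  have w_lim: "filterlim (\<lambda>n. c * w n) (at_right 0) sequentially" if "0 < c" for c
    unfolding filterlim_at
  proof
    show "(\<lambda>n. c * w n) \<longlonglongrightarrow> 0"
      using tendsto_mult_right_zero [OF k_small] by (simp add: w_def)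
    show "\<forall>\<^sub>F n in sequentially. c * w n \<in> {0<..} \<and> c * w n \<noteq> 0"
      using k_range by eventually_elim (use that in \<open>auto simp: w_def\<close>)
  qed
  have w_small: "\<forall>\<^sub>F n in sequentially. c * w n < b" if "0 < b" for b c
    using tendsto_mult_right_zero [OF k_small, of c] that
    by (intro order_tendstoD(2) [where y = 0]) (auto simp: w_def)
  have ln_ge1: "\<forall>\<^sub>F n in sequentially. 1 \<le> ln (real n)" by real_asymp
  have ln_le_k: "\<forall>\<^sub>F n in sequentially. ln (real n) powr \<delta> \<le> c * real (k n)" if "0 < c" for c
  proof -
    have "\<forall>\<^sub>F n in sequentially. ln (real n) powr \<delta> / real (k n) < c"
      using k_large that by (rule order_tendstoD)
    with k_range show ?thesis by eventually_elim (auto simp: field_simps)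
  qed

  \<comment> \<open>Counts at levels \<open>q (c * w n)\<close> and location of the random
    threshold\<close>
  have count_w: "\<forall>\<^sub>F n in sequentially. N n (q (c * w n)) \<le> \<rho> * (c * real (k n)) \<and>
      c * real (k n) / \<rho> \<le> N' n (q (c * w n))"
    if "1 < \<rho>" "\<rho> \<le> 2" "0 < c" for \<rho> c
  proof -
    have "\<forall>\<^sub>F n in sequentially. c * w n < 1 / 2"
      by (rule w_small) simp
    with count [OF that(1,2)] k_range ln_ge1 ln_le_k [OF that(3)] show ?thesis
    proof eventually_elim
      case (elim n)
      have "ln (real n) powr (\<delta> / 2) \<le> ln (real n) powr \<delta>"
        using elim(3) \<delta> by (intro powr_mono) auto
      moreover have nw: "real n * (c * w n) = c * real (k n)" and "0 < c * w n"
        using elim that by (auto simp: w_def)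
      ultimately have "0 < c * w n \<and> c * w n < 1 / 2 \<and>
          ln (real n) powr (\<delta> / 2) \<le> real n * (c * w n)"
        using elim by linarith
      from elim(1) [rule_format, OF this] show ?case
        unfolding N_def N'_def nw .
    qed
  qed
  \<comment> \<open>About \<open>\<rho>\<^sup>2 * k n\<close> observations are expected above the
    lower level; after losing a factor \<open>\<rho>\<close> there are still more than
    \<open>k n\<close>. The upper level is symmetric.\<close>
  have T_bounds: "\<forall>\<^sub>F n in sequentially. q (\<rho>\<^sup>2 * w n) \<le> T n \<and> T n \<le> q (1 / \<rho>\<^sup>2 * w n)"
    if \<rho>: "1 < \<rho>" "\<rho> \<le> 2" for \<rho>
  proof -
    have \<rho>2: "0 < \<rho>\<^sup>2" "0 < 1 / \<rho>\<^sup>2" using \<rho> by auto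
    from count_w [OF \<rho> \<rho>2(1)] count_w [OF \<rho> \<rho>2(2)] k_range show ?thesis
    proof eventually_elim
      case (elim n)
      have k_less: "1 * real (k n) < \<rho> * real (k n)" using \<rho> elim by (intro mult_strict_right_mono) auto
      moreover have "\<rho>\<^sup>2 * real (k n) / \<rho> = \<rho> * real (k n)"
        using \<rho> by (simp add: power2_eq_square)
      ultimately have "real (k n) < N' n (q (\<rho>\<^sup>2 * w n))" using elim by linarith
      then have lower: "q (\<rho>\<^sup>2 * w n) \<le> T n"
        unfolding T_def using elim by (intro order_statistic_geI) (auto simp: N'_def)
      have "N n (q (1 / \<rho>\<^sup>2 * w n)) \<le> \<rho> * (1 / \<rho>\<^sup>2 * real (k n))" using elim by blast
      also have "\<dots> \<le> real (k n)" using \<rho> k_less by (simp add: power2_eq_square field_simps)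
      finally have "T n \<le> q (1 / \<rho>\<^sup>2 * w n)"
        unfolding T_def using elim by (intro order_statistic_leI) (auto simp: N_def)
      with lower show ?case by simp
    qed
  qed
  have T_pos: "\<forall>\<^sub>F n in sequentially. 0 < T n"
  proof -
    have "\<forall>\<^sub>F n in sequentially. 0 < q (2\<^sup>2 * w n)"
      by (intro eventually_compose_filterlim [OF q_pos w_lim]) simp
    moreover have "\<forall>\<^sub>F n in sequentially. q (2\<^sup>2 * w n) \<le> T n \<and> T n \<le> q (1 / 2\<^sup>2 * w n)"
      by (rule T_bounds) auto
    ultimately show ?thesis by eventually_elim linarith
  qed

  \<comment> \<open>Pointwise limit of the normalised exceedance counts\<close>
  have N_lim: "(\<lambda>n. N n (T n * exp (\<gamma> * s)) / real (k n)) \<longlonglongrightarrow> exp (- s)" if "0 < s" for s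
  proof -
    have upper: "\<forall>\<^sub>F n in sequentially. N n (T n * exp (\<gamma> * s)) / real (k n) \<le> \<rho> ^ 4 * exp (- s)"
      if \<rho>: "1 < \<rho>" "\<rho> \<le> 2" for \<rho>
    proof -
      \<comment> \<open>The extra \<open>\<rho>\<close> makes the limit
        \<open>c powr (- \<gamma>)\<close> of the ratio strictly smaller than
        \<open>exp (\<gamma> * s)\<close>. In total \<open>\<rho> ^ 4\<close> arises:
        \<open>\<rho>\<close> from \<open>c\<close>, \<open>\<rho>\<^sup>2\<close> from the
        threshold, \<open>\<rho>\<close> from the count.\<close>
      define c where "c = \<rho> * exp (- s)"
      have c: "0 < c" "0 < \<rho>\<^sup>2" "0 < c * \<rho>\<^sup>2" using \<rho> by (auto simp: c_def)
      have "c powr (- \<gamma>) = \<rho> powr (- \<gamma>) * exp (\<gamma> * s)"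
        using \<rho> by (simp add: c_def powr_mult exp_powr_real mult.commute)
      also have "\<dots> < exp (\<gamma> * s)" using \<rho> \<gamma> by (simp add: powr_less_one)
      finally have "\<forall>\<^sub>F z in at_right 0. q (c * z) / q z < exp (\<gamma> * s)"
        by (rule order_tendstoD(2) [OF q_ratio [OF c(1)]])
      then have "\<forall>\<^sub>F z in at_right 0. q (c * z) < q z * exp (\<gamma> * s)"
        using q_pos by eventually_elim (auto simp: field_simps)
      from eventually_compose_filterlim [OF this w_lim [OF c(2)]]
        T_bounds [OF \<rho>] count_w [OF \<rho> c(3)] k_range
      show ?thesis
      proof eventually_elim
        case (elim n)
        have "q (\<rho>\<^sup>2 * w n) * exp (\<gamma> * s) \<le> T n * exp (\<gamma> * s)"
          using elim by (intro mult_right_mono) auto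
        then have "q (c * \<rho>\<^sup>2 * w n) \<le> T n * exp (\<gamma> * s)"
          using elim(1) unfolding mult.assoc by linarith
        then have "N n (T n * exp (\<gamma> * s)) \<le> N n (q (c * \<rho>\<^sup>2 * w n))"
          by (rule N_antimono)
        also have "\<dots> \<le> \<rho> * (c * \<rho>\<^sup>2 * real (k n))" using elim by blast
        also have "\<dots> = \<rho> ^ 4 * exp (- s) * real (k n)"
          by (simp add: c_def eval_nat_numeral)
        finally show ?case using elim by (simp add: field_simps)
      qed
    qed
    have lower: "\<forall>\<^sub>F n in sequentially. exp (- s) / \<rho> ^ 4 \<le> N n (T n * exp (\<gamma> * s)) / real (k n)"
      if \<rho>: "1 < \<rho>" "\<rho> \<le> 2" for \<rho>
    proof -
      \<comment> \<open>The mirror image: now the limiting ratio is strictly larger. Strictness also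
        allows passing from weak exceedances of the quantile level to strict ones of the random
        level.\<close>
      define c where "c = exp (- s) / \<rho>"
      have c: "0 < c" "0 < 1 / \<rho>\<^sup>2" "0 < c * (1 / \<rho>\<^sup>2)" using \<rho> by (auto simp: c_def)
      have "exp (\<gamma> * s) < \<rho> powr \<gamma> * exp (\<gamma> * s)" using \<rho> \<gamma> by (simp add: gr_one_powr)
      also have "\<dots> = exp (- s) powr (- \<gamma>) / \<rho> powr (- \<gamma>)"
        by (simp add: powr_minus exp_powr_real exp_minus_inverse field_simps)
      also have "\<dots> = c powr (- \<gamma>)"
        using \<rho> unfolding c_def by (subst powr_divide) auto
      finally have "\<forall>\<^sub>F z in at_right 0. exp (\<gamma> * s) < q (c * z) / q z"
        by (rule order_tendstoD(1) [OF q_ratio [OF c(1)]])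
      then have "\<forall>\<^sub>F z in at_right 0. q z * exp (\<gamma> * s) < q (c * z)"
        using q_pos by eventually_elim (auto simp: field_simps)
      from eventually_compose_filterlim [OF this w_lim [OF c(2)]]
        T_bounds [OF \<rho>] count_w [OF \<rho> c(3)] k_range
      show ?thesis
      proof eventually_elim
        case (elim n)
        have "T n * exp (\<gamma> * s) \<le> q (1 / \<rho>\<^sup>2 * w n) * exp (\<gamma> * s)"
          using elim by (intro mult_right_mono) auto
        then have "T n * exp (\<gamma> * s) < q (c * (1 / \<rho>\<^sup>2) * w n)"
          using elim(1) unfolding mult.assoc by linarith
        then have "N' n (q (c * (1 / \<rho>\<^sup>2) * w n)) \<le> N n (T n * exp (\<gamma> * s))"
          by (rule N'_le)
        moreover have "c * (1 / \<rho>\<^sup>2) * real (k n) / \<rho> = exp (- s) / \<rho> ^ 4 * real (k n)"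
          by (simp add: c_def eval_nat_numeral)
        ultimately have "exp (- s) / \<rho> ^ 4 * real (k n) \<le> N n (T n * exp (\<gamma> * s))"
          using elim by linarith
        then show ?case using elim by (subst pos_le_divide_eq) auto
      qed
    qed
    \<comment> \<open>For each target \<open>a\<close> a fixed \<open>\<rho>\<close> close enough to
      1 is chosen before \<open>n\<close> tends to infinity.\<close>
    have range: "\<forall>\<^sub>F \<rho> in at_right (1::real). 1 < \<rho> \<and> \<rho> \<le> 2"
      unfolding eventually_at_right_field by (intro exI [of _ 2]) auto
    show ?thesis
    proof (rule order_tendstoI)
      fix a assume "a < exp (- s)"
      moreover have "((\<lambda>\<rho>. exp (- s) / \<rho> ^ 4) \<longlongrightarrow> exp (- s)) (at_right 1)"
        by (auto intro!: tendsto_eq_intros)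
      ultimately have "\<forall>\<^sub>F \<rho> in at_right 1. a < exp (- s) / \<rho> ^ 4"
        by (intro order_tendstoD)
      from eventually_happens' [OF trivial_limit_at_right_real eventually_conj [OF range this]]
      obtain \<rho> where \<rho>: "1 < \<rho>" "\<rho> \<le> 2" "a < exp (- s) / \<rho> ^ 4" by blast
      from lower [OF \<rho>(1,2)]
      show "\<forall>\<^sub>F n in sequentially. a < N n (T n * exp (\<gamma> * s)) / real (k n)"
        by eventually_elim (use \<rho> in linarith)
    next
      fix a assume "exp (- s) < a"
      moreover have "((\<lambda>\<rho>. \<rho> ^ 4 * exp (- s)) \<longlongrightarrow> exp (- s)) (at_right 1)"
        by (auto intro!: tendsto_eq_intros)
      ultimately have "\<forall>\<^sub>F \<rho> in at_right 1. \<rho> ^ 4 * exp (- s) < a"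
        by (intro order_tendstoD)
      from eventually_happens' [OF trivial_limit_at_right_real eventually_conj [OF range this]]
      obtain \<rho> where \<rho>: "1 < \<rho>" "\<rho> \<le> 2" "\<rho> ^ 4 * exp (- s) < a" by blast
      from upper [OF \<rho>(1,2)]
      show "\<forall>\<^sub>F n in sequentially. N n (T n * exp (\<gamma> * s)) / real (k n) < a"
        by eventually_elim (use \<rho> in linarith)
    qed
  qed

  \<comment> \<open>This choice makes \<open>k powr (1 - a) * (ln n) powr (- 2 * a) \<ge> (ln n) powr (\<delta> / 2)\<close>.\<close>
  define a where "a = \<delta> / (2 * (\<delta> + 2))"
  have a: "0 < a" "a \<le> 1" using \<delta> by (auto simp: a_def field_simps)
  have "a * (\<delta> + 2) = \<delta> / 2" 
    unfolding a_def times_divide_eq_left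
    by (rule nonzero_mult_divide_mult_cancel_right) (use \<delta> in simp)
  then have a_eq: "\<delta> * (1 - a) - 2 * a = \<delta> / 2" by (simp add: algebra_simps)

  \<comment> \<open>Power bound for counts, uniform in the level\<close>
  have count_le: "\<forall>\<^sub>F n in sequentially. \<forall>z::real. 0 < z \<and> z \<le> 1 \<longrightarrow>
      N n (q (2\<^sup>2 * w n * z)) \<le> 8 * real (k n) * z powr a"
  proof -
    have "\<forall>\<^sub>F n in sequentially. 2\<^sup>2 * w n < 1 / 2"
      by (rule w_small) simp
    with count [of 2, simplified] max_le k_range ln_ge1 ln_le_k [of 1, simplified]
    show ?thesis
    proof eventually_elim
      case (elim n)
      define L where "L = ln (real n)"
      have L: "1 \<le> L" "L powr \<delta> \<le> real (k n)" using elim by (auto simp: L_def)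
      have kn: "1 \<le> real (k n)" "0 < real n" using elim by auto
      have w4: "2\<^sup>2 * w n < 1 / 2" by fact
      have w_pos: "0 < w n" and nw: "real n * w n = real (k n)" using kn by (auto simp: w_def)
      show ?case
      proof (intro allI impI)
        fix z :: real assume z: "0 < z \<and> z \<le> 1"
        define u where "u = 2\<^sup>2 * w n * z"
        have "u \<le> 2\<^sup>2 * w n * 1" unfolding u_def using z w_pos by (intro mult_left_mono) auto
        then have "u < 1 / 2" using w4 by linarith
        moreover have "0 < u" using z w_pos by (simp add: u_def)
        ultimately have u: "0 < u" "u < 1 / 2" by auto
        have nu: "real n * u = 4 * real (k n) * z" using nw by (simp add: u_def)
        \<comment> \<open>Three regimes for \<open>n * u\<close>. Above
          \<open>L powr (\<delta> / 2)\<close> the count is at most twice the mean, and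
          \<open>z \<le> z powr a\<close>. Below \<open>L powr (- 2)\<close> nothing exceeds
          \<open>q u\<close>. In between the count is at most that at \<open>u'\<close>, hence at
          most \<open>2 * L powr (\<delta> / 2)\<close>; by the choice of \<open>a\<close> this
          power splits into \<open>L powr \<delta> \<le> k n\<close> and
          \<open>L powr (- 2) \<le> n * u = 4 * k n * z\<close> with exponents \<open>1 - a\<close>
          and \<open>a\<close>.\<close>
        show "N n (q (2\<^sup>2 * w n * z)) \<le> 8 * real (k n) * z powr a"
          unfolding u_def [symmetric]
        proof (cases "L powr (\<delta> / 2) \<le> real n * u")
          case True
          then have "N n (q u) \<le> 2 * (real n * u)"
            using elim(1) u by (auto simp: N_def L_def)
          also have "\<dots> = 8 * real (k n) * z powr 1" using nu z by simp
          also have "\<dots> \<le> 8 * real (k n) * z powr a"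
            using z a by (intro mult_left_mono powr_mono') auto
          finally show "N n (q u) \<le> 8 * real (k n) * z powr a" .
        next
          case False
          show "N n (q u) \<le> 8 * real (k n) * z powr a"
          proof (cases "real n * u * L\<^sup>2 < 1")
            case True
            then have "\<forall>i\<in>{1..n}. X i \<omega> \<le> q u" using elim(2) u by (auto simp: L_def)
            then have "{i \<in> {1..n}. q u < X i \<omega>} = {}" by force
            then show ?thesis by (simp only: N_def card.empty) simp
          next
            case large: False
            define u' where "u' = L powr (\<delta> / 2) / real n"
            have nu': "real n * u' = L powr (\<delta> / 2)" using kn by (simp add: u'_def)
            have "L powr (\<delta> / 2) \<le> L powr \<delta>" using L \<delta> by (intro powr_mono) auto
            then have u'_le: "u' \<le> w n"
              unfolding u'_def w_def using L kn by (intro divide_right_mono) auto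
            have "0 < u'" using L kn by (simp add: u'_def)
            moreover have "u' < 1 / 2" using u'_le w4 w_pos by simp
            ultimately have u': "0 < u'" "u' < 1 / 2" by auto
            have "u \<le> u'" using False kn by (simp add: u'_def field_simps)
            then have "N n (q u) \<le> N n (q u')" using u u' by (intro N_antimono q_antimono) auto
            also have "\<dots> \<le> 2 * L powr (\<delta> / 2)"
              using elim(1) [rule_format, of u'] u' nu' by (auto simp: N_def L_def)
            also have "L powr (\<delta> / 2) = (L powr \<delta>) powr (1 - a) * (L powr (- 2)) powr a"
              by (simp add: powr_powr flip: powr_add a_eq)
            also have "\<dots> \<le> real (k n) powr (1 - a) * (4 * real (k n) * z) powr a"
            proof (intro mult_mono powr_mono2)
              show "L powr (- 2) \<le> 4 * real (k n) * z"
                using large L unfolding nu by (simp add: powr_minus field_simps)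
            qed (use L a in auto)
            also have "\<dots> = real (k n) * (4 powr a * z powr a)"
              using kn z by (simp add: powr_mult mult.assoc) (simp add: mult.assoc [symmetric] powr_add [symmetric] ac_simps)
            also have "\<dots> \<le> real (k n) * (4 powr 1 * z powr a)"
              using a z by (intro mult_left_mono mult_right_mono powr_mono) auto
            finally show ?thesis by simp
          qed
        qed
      qed
    qed
  qed

  \<comment> \<open>Potter-type bound for \<open>q\<close> and the exponential majorant\<close>
  obtain e where e: "0 < e" "\<And>v. 0 < v \<Longrightarrow> v < e \<Longrightarrow> 0 < q v \<and> q (v / 2) \<le> 4 powr \<gamma> * q v"
  proof -
    \<comment> \<open>Halving the argument multiplies \<open>q\<close> by about
      \<open>2 powr \<gamma>\<close>; the larger constant \<open>4 powr \<gamma>\<close> gives a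
      bound valid on a whole interval \<open>0 < v < e\<close>, which can be iterated.\<close>
    have "(1 / 2) powr (- \<gamma>) < 4 powr \<gamma>"
      using \<gamma> by (simp add: powr_minus_divide powr_divide powr_less_mono2)
    then have "\<forall>\<^sub>F s in at_right 0. q (1 / 2 * s) / q s < 4 powr \<gamma>"
      by (intro order_tendstoD(2) [OF q_ratio]) auto
    with q_pos have "\<forall>\<^sub>F s in at_right 0. 0 < q s \<and> q (s / 2) \<le> 4 powr \<gamma> * q s"
      by eventually_elim (auto simp: field_simps)
    then show thesis using that unfolding eventually_at_right_field by auto
  qed
  have q_halve: "q (v * (1 / 2) ^ j) \<le> 4 powr (\<gamma> * real j) * q v" if v: "0 < v" "v < e" for v j
  proof (induction j)
    case (Suc j)
    have "v * (1 / 2) ^ j \<le> v * 1" using v by (intro mult_left_mono power_le_one) auto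
    then have "v * (1 / 2) ^ j < e" using v by linarith
    then have "q (v * (1 / 2) ^ j / 2) \<le> 4 powr \<gamma> * q (v * (1 / 2) ^ j)"
      using v e(2) [of "v * (1 / 2) ^ j"] by simp
    also have "\<dots> \<le> 4 powr \<gamma> * (4 powr (\<gamma> * real j) * q v)"
      using Suc by (intro mult_left_mono) auto
    finally show ?case by (simp add: powr_add algebra_simps)
  qed simp
  have dom: "\<forall>\<^sub>F n in sequentially. \<forall>s\<ge>0. \<bar>N n (T n * exp (\<gamma> * s)) / real (k n)\<bar>
      \<le> 16 * exp (- (a / 2) * s)"
  proof -
    have "\<forall>\<^sub>F n in sequentially. 2\<^sup>2 * w n < e"
      using e by (intro w_small)
    with count_le T_bounds [of 2, simplified] k_range T_pos show ?thesis
    proof eventually_elim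
      case (elim n)
      have w_pos: "0 < w n" using elim by (auto simp: w_def)
      show ?case
      proof (intro allI impI)
        fix s :: real assume s: "0 \<le> s"
        \<comment> \<open>The largest number of halvings with
          \<open>4 powr (\<gamma> * j) \<le> exp (\<gamma> * s)\<close>, so that
          \<open>q (4 * w n / 2 ^ j) \<le> T n * exp (\<gamma> * s)\<close>. Since
          \<open>4 = 2^2\<close>, maximality gives \<open>2 ^ j \<ge> exp (s / 2) / 2\<close>; this
          yields the rate \<open>a / 2\<close> and, with \<open>2 powr a \<le> 2\<close>, the
          constant \<open>16 = 8 * 2\<close>.\<close>
        define j where "j = nat \<lfloor>s / ln 4\<rfloor>"
        have "0 \<le> s / ln 4" using s by simp
        then have "real j \<le> s / ln 4" "s / ln 4 \<le> real j + 1" unfolding j_def by linarith+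
        then have j: "real j * ln 4 \<le> s" "s \<le> (real j + 1) * ln 4" by (auto simp: field_simps)
        have ln4: "ln 4 = 2 * ln (2::real)" using ln_realpow [of 2 2] by simp
        have "q (2\<^sup>2 * w n * (1 / 2) ^ j) \<le> 4 powr (\<gamma> * real j) * q (2\<^sup>2 * w n)"
          using elim w_pos by (intro q_halve) auto
        also have "\<dots> \<le> 4 powr (\<gamma> * real j) * T n"
          using elim by (intro mult_left_mono) auto
        also have "\<dots> \<le> exp (\<gamma> * s) * T n"
          using elim j \<gamma> by (intro mult_right_mono) (auto simp: powr_def mult.assoc)
        finally have "N n (T n * exp (\<gamma> * s)) \<le> N n (q (2\<^sup>2 * w n * (1 / 2) ^ j))"
          by (intro N_antimono) (simp add: mult.commute)
        also have "\<dots> \<le> 8 * real (k n) * ((1 / 2) ^ j) powr a"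
          using elim(1) by (auto simp: power_le_one)
        also have "((1 / 2 :: real) ^ j) powr a = exp (- (real j * ln 2) * a)"
          by (simp add: powr_def ln_realpow ln_div mult.commute)
        also have "\<dots> \<le> exp (ln 2 + - (a / 2) * s)"
        proof -
          have "s / 2 \<le> real j * ln 2 + ln 2" using j ln4 by (simp add: algebra_simps)
          then have "s / 2 * a \<le> (real j * ln 2 + ln 2) * a" using a by (intro mult_right_mono) auto
          moreover have "ln 2 * a \<le> ln 2 * 1" using a by (intro mult_left_mono) auto
          ultimately have "- (real j * ln 2) * a \<le> ln 2 + - (a / 2) * s"
            unfolding distrib_right minus_mult_left [symmetric] times_divide_eq_left
            by (simp only: mult.commute [of a s])
          then show ?thesis by (simp only: exp_le_cancel_iff)
        qed
        also have "\<dots> = 2 * exp (- (a / 2) * s)" by (subst exp_add) simp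
        finally have "N n (T n * exp (\<gamma> * s)) \<le> 8 * real (k n) * (2 * exp (- (a / 2) * s))"
          by (simp add: mult_left_mono)
        moreover have "0 \<le> N n (T n * exp (\<gamma> * s))" by (simp add: N_def)
        ultimately show "\<bar>N n (T n * exp (\<gamma> * s)) / real (k n)\<bar> \<le> 16 * exp (- (a / 2) * s)"
          using elim by (simp add: field_simps)
      qed
    qed
  qed

  \<comment> \<open>Conclusion by dominated convergence\<close>
  define y where "y n = S_stat X k p n \<omega> / (\<gamma> powr p * p)" for n
  have "y \<longlonglongrightarrow> Gamma p"
  proof (rule tendsto_Gamma_of_tail_functions [OF p _ _ dom N_lim])
    show "\<forall>\<^sub>F n in sequentially.
        ((\<lambda>s. N n (T n * exp (\<gamma> * s)) / real (k n) * s powr (p - 1)) has_integral y n) {0..}"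
      using T_pos k_range
    proof eventually_elim
      case (elim n)
      have "S_stat X k p n \<omega> = 1 / real (k n) *
          (\<Sum>i=1..n. if T n < X i \<omega> then ln (X i \<omega> / T n) powr p else 0)"
        unfolding T_def using elim p by (intro S_stat_eq_sum_exceedances) (auto simp: T_def)
      then show ?case
        using has_integral_mult_right [OF has_integral_exceedance_count
            [OF elim(1) \<gamma> p, of n "\<lambda>i. X i \<omega>"], of "1 / real (k n)"]
        by (simp add: N_def y_def mult.assoc)
    qed
  qed (use a in auto)
  then have "(\<lambda>n. y n * (\<gamma> powr p * p)) \<longlonglongrightarrow> Gamma p * (\<gamma> powr p * p)"
    by (intro tendsto_intros)
  moreover have "Gamma (p + 1) = p * Gamma p"
    using p by (intro Gamma_plus1) (auto elim: nonpos_Ints_cases)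
  ultimately show ?thesis
    using \<gamma> p by (simp add: y_def mult_ac)
qed

lemma slowly_varying_at_0_pos:
  "slowly_varying_at_0 l \<Longrightarrow> \<forall>\<^sub>F s in at_right 0. 0 < l s"
  unfolding slowly_varying_at_0_def eventually_at_right_field by auto

text \<open>The powers of \<open>s\<close> cancel in the ratio, and slow variation handles the rest.
  The representation is available only on the unit interval, so \<open>s\<close> and
  \<open>c * s\<close> must both be below 1.\<close>

lemma regularly_varying_ratio_tendsto:
  fixes q l :: "real \<Rightarrow> real" and c \<gamma> :: real
  assumes l: "slowly_varying_at_0 l" and q: "\<And>s. s \<in> {0<..<1} \<Longrightarrow> q s = s powr (- \<gamma>) * l s"
    and c: "0 < c"
  shows "((\<lambda>s. q (c * s) / q s) \<longlongrightarrow> c powr (- \<gamma>)) (at_right 0)"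
proof -
  have "((\<lambda>s. c powr (- \<gamma>) * (l (c * s) / l s)) \<longlongrightarrow> c powr (- \<gamma>) * 1) (at_right 0)"
    using l c unfolding slowly_varying_at_0_def by (intro tendsto_mult tendsto_const) auto
  moreover have "\<forall>\<^sub>F s in at_right 0. c powr (- \<gamma>) * (l (c * s) / l s) = q (c * s) / q s"
    unfolding eventually_at_right_field
  proof (intro exI [of _ "min 1 (1 / c)"] conjI allI impI)
    fix s assume "0 < s" "s < min 1 (1 / c)"
    then have "s \<in> {0<..<1}" "c * s \<in> {0<..<1}" using c by (auto simp: field_simps)
    then show "c powr (- \<gamma>) * (l (c * s) / l s) = q (c * s) / q s"
      using c by (simp add: q powr_mult)
  qed (use c in auto)
  ultimately show ?thesis by (simp add: tendsto_cong)
qed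

theorem theorem2p3:
  fixes M :: "'a measure" and X :: "nat \<Rightarrow> 'a \<Rightarrow> real" and F l :: "real \<Rightarrow> real"
    and k :: "nat \<Rightarrow> nat" and \<gamma> p \<delta> :: real
  assumes "prob_space M"
    and "prob_space.indep_vars M (\<lambda>_. borel) X {1..}"
    and "\<And>i. 1 \<le> i \<Longrightarrow> cdf (distr M borel (X i)) = F"
    and "0 < \<gamma>"
    and "slowly_varying_at_0 l"
    and "\<And>s. s \<in> {0<..<1} \<Longrightarrow> quantile F (1 - s) = s powr (- \<gamma>) * l s"
    and "0 < p"
    and "\<And>n. 1 \<le> n \<Longrightarrow> 1 \<le> k n \<and> k n \<le> n"
    and "filterlim k at_top sequentially"
    and "(\<lambda>n. real (k n) / real n) \<longlonglongrightarrow> 0"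
    and "0 < \<delta>"
    and "(\<lambda>n. ln (real n) powr \<delta> / real (k n)) \<longlonglongrightarrow> 0"
  shows "(AE \<omega> in M. (\<lambda>n. S_stat X k p n \<omega>) \<longlonglongrightarrow> \<gamma> powr p * Gamma (p + 1)) \<and>
         (AE \<omega> in M. (\<lambda>n. gamma_hat X k p n \<omega>) \<longlonglongrightarrow> \<gamma>)"
proof -
  interpret iid_sample M X F
    using assms(1-3) by (auto simp: iid_sample_def iid_sample_axioms_def)
  have q_eq: "q s = s powr (- \<gamma>) * l s" if "s \<in> {0<..<1}" for s
    using assms(6) [OF that] by (simp add: tail_quantile_def)
  have "\<forall>\<^sub>F s in at_right (0::real). s \<in> {0<..<1}"
    unfolding eventually_at_right_field by (intro exI [of _ 1]) auto
  with slowly_varying_at_0_pos [OF assms(5)] have q_pos: "\<forall>\<^sub>F s in at_right 0. 0 < q s"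
    by eventually_elim (auto simp: q_eq)
  \<comment> \<open>The exceptional null set depends on the factor. Countably many factors
    decreasing to 1 suffice, since bounds with a smaller factor imply those with a larger
    one.\<close>
  define \<rho> where "\<rho> m = 1 + 1 / real (Suc m)" for m
  have \<rho>: "1 < \<rho> m" "\<rho> m \<le> 2" for m by (auto simp: \<rho>_def field_simps)
  have \<rho>_lim: "\<rho> \<longlonglongrightarrow> 1" unfolding \<rho>_def by real_asymp
  have "AE \<omega> in M. \<forall>m. \<forall>\<^sub>F n in sequentially. \<forall>u.
      0 < u \<and> u < 1 / 2 \<and> ln (real n) powr (\<delta> / 2) \<le> real n * u \<longrightarrow>
      real (card {i \<in> {1..n}. q u < X i \<omega>}) \<le> \<rho> m * (real n * u) \<and>
      real n * u / \<rho> m \<le> real (card {i \<in> {1..n}. q u \<le> X i \<omega>})"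
    unfolding AE_all_countable using assms(11) by (intro allI AE_eventually_count_bounds \<rho>) auto
  with AE_eventually_max_le
  have S_lim: "AE \<omega> in M. (\<lambda>n. S_stat X k p n \<omega>) \<longlonglongrightarrow> \<gamma> powr p * Gamma (p + 1)"
  proof eventually_elim
    case (elim \<omega>)
    show ?case
    proof (rule S_stat_tendsto [where q = q and \<delta> = \<delta>])
      fix r :: real assume r: "1 < r" "r \<le> 2"
      from order_tendstoD(2) [OF \<rho>_lim r(1)] obtain m where m: "\<rho> m < r"
        by (auto dest: eventually_happens)
      from elim(2) [rule_format, of m]
      show "\<forall>\<^sub>F n in sequentially. \<forall>u.
        0 < u \<and> u < 1 / 2 \<and> ln (real n) powr (\<delta> / 2) \<le> real n * u \<longrightarrow>
        real (card {i \<in> {1..n}. q u < X i \<omega>}) \<le> r * (real n * u) \<and>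
        real n * u / r \<le> real (card {i \<in> {1..n}. q u \<le> X i \<omega>})"
      proof eventually_elim
        case (elim n)
        show ?case
        proof (intro allI impI)
          fix u assume u: "0 < u \<and> u < 1 / 2 \<and> ln (real n) powr (\<delta> / 2) \<le> real n * u"
          have "\<rho> m * (real n * u) \<le> r * (real n * u)"
            using m u by (intro mult_right_mono) auto
          moreover have "real n * u / r \<le> real n * u / \<rho> m"
            using m u \<rho>(1) [of m] by (intro divide_left_mono mult_pos_pos) auto
          ultimately show "real (card {i \<in> {1..n}. q u < X i \<omega>}) \<le> r * (real n * u) \<and>
            real n * u / r \<le> real (card {i \<in> {1..n}. q u \<le> X i \<omega>})"
            using elim [rule_format, OF u] by linarith
        qed
      qed
    qed (use assms elim q_pos tail_quantile_antimono
          regularly_varying_ratio_tendsto [OF assms(5) q_eq] in auto)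
  qed
  moreover from S_lim have "AE \<omega> in M. (\<lambda>n. gamma_hat X k p n \<omega>) \<longlonglongrightarrow> \<gamma>"
  proof eventually_elim
    case (elim \<omega>)
    have G: "0 < Gamma (p + 1)" using assms(7) by (intro Gamma_real_pos) auto
    \<comment> \<open>Continuity of the power \<open>1 / p\<close> at the positive point
      \<open>\<gamma> powr p\<close>.\<close>
    have "(\<lambda>n. (S_stat X k p n \<omega> / Gamma (p + 1)) powr (1 / p))
        \<longlonglongrightarrow> (\<gamma> powr p * Gamma (p + 1) / Gamma (p + 1)) powr (1 / p)"
      using elim G assms(4) by (intro tendsto_intros) auto
    then show ?case
      using G assms(4,7) by (simp add: gamma_hat_def powr_powr)
  qed
  ultimately show ?thesis ..
qed

end
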